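(* There is a fixed $\varepsilon>0$ such that if $p>1-\varepsilon$ and $\mathcal{X}$ is the random subset of $2^{[n]}$ in which each $A\subseteq[n]$ is present independently with probability $p$, then with probability tending to $1$ as $n\to\infty$, \[ w(\mathcal{X})=\max\Big\{\big|\mathcal{X}\cap \tbinom{[n]}{\lfloor n/2\rfloor}\big|,\ \big|\mathcal{X}\cap \tbinom{[n]}{\lceil n/2\rceil}\big|\Big\}. \]
   Context: $\binom{[n]}{\ell}$ denotes the family of $\ell$-element subsets of $[n]=\{1,\dots,n\}$. The width $w(\mathcal{X})$ of a family $\mathcal{X}\subseteq 2^{[n]}$ is the maximum size of an antichain (a collection of pairwise inclusion-incomparable sets) contained in $\mathcal{X}$. *)

theory Defs
  imports "HOL-Probability.Probability" "HOL-Probability.Product_PMF" "HOL-Library.Ramsey"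
begin

definition antichain :: "'a set set \<Rightarrow> bool" where
  "antichain \<A> \<longleftrightarrow> pairwise (\<lambda>A B. \<not> A \<subseteq> B \<and> \<not> B \<subseteq> A) \<A>"

text \<open>Only meaningful for finite \<open>\<X>\<close>; the empty antichain gives width 0 to the empty family.\<close>

definition width :: "'a set set \<Rightarrow> nat" where
  "width \<X> = Max {card \<A> |\<A>. \<A> \<subseteq> \<X> \<and> antichain \<A>}"

text \<open>The law of the random family containing each subset of \<open>{1..n}\<close> independently with
  probability \<open>p\<close>: \<open>f A\<close> is the indicator of the event that \<open>A\<close> is present.\<close>

definition random_family :: "nat \<Rightarrow> real \<Rightarrow> nat set set pmf" where
  "random_family n p =
     map_pmf (\<lambda>f. {A \<in> Pow {1..n}. f A}) (Pi_pmf (Pow {1..n}) False (\<lambda>_. bernoulli_pmf p))"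

end

theory Submission
  imports Defs "HOL-Real_Asymp.Real_Asymp"
begin

text \<open>
  Antichains are pushed to the middle of the cube by replacing their lowest level with its shadow
  inside \<open>\<X>\<close> (and dually), so it suffices that \<open>|N(A)| \<ge> |A|\<close> for every \<open>A\<close> contained in a level \<open>i\<close>
  of \<open>\<X>\<close> below the middle, where \<open>N(A)\<close> is the set of upper neighbours of \<open>A\<close> in \<open>\<X>\<close>; for the two
  middle levels of an odd cube this is needed from the smaller one to the larger one. For \<open>i < n / 3\<close>
  comparing degrees suffices.

  Put \<open>T = N(A)\<close> and let \<open>D\<close> be the number of comparable pairs in \<open>\<X>\<close> between \<open>T\<close> and the part of
  level \<open>i\<close> outside \<open>A\<close>. Counting edges, \<open>D = \<Sum>\<^bsub>y \<in> T\<^esub> d(y) - \<Sum>\<^bsub>x \<in> A\<^esub> d(x)\<close>. The deviation of the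
  degrees from their means, summed over \<open>A\<close>, is compared with its average over the sets at Johnson
  distance 2. Those averages are tiny, by Hoeffding's inequality conditionally on level \<open>i\<close>, and
  the error made is at most a small multiple of \<open>D\<close>, because every pair at distance 2 separated by
  \<open>A\<close> is joined by many paths in \<open>\<X>\<close> that cross one of the \<open>D\<close> edges; this uses that almost all
  neighbours of every set are present, which holds for \<open>p\<close> close to 1. Hence
  \<open>0.8 D + p (n - i) |A| \<le> p (i + 1) |T| + c |A|\<close> with a tiny \<open>c\<close> as soon as \<open>|T| \<le> |A|\<close>, which
  contradicts \<open>|T| < |A|\<close> if \<open>n - i > i + 1\<close>. If \<open>n = 2 i + 1\<close>, the same inequality for the complements
  of \<open>A\<close> and \<open>T\<close> bounds \<open>D\<close> by a small multiple of the smaller part of level \<open>i\<close>, which contradicts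
  isoperimetry in the Johnson graph.
\<close>

section \<open>Counting in the Johnson graph\<close>

text \<open>Negating both predicates leaves the mismatches unchanged, which is used when passing to
  complements. If \<open>f\<close> and \<open>g\<close> are membership in \<open>A\<close> and
  \<open>T\<close> and all upper neighbours of \<open>A\<close> in \<open>U\<close> lie in
  \<open>T\<close>, the mismatches are the edges from \<open>T\<close> down to the part of
  \<open>L\<close> outside \<open>A\<close>.\<close>

definition mismatches :: "('a set \<Rightarrow> bool) \<Rightarrow> ('a set \<Rightarrow> bool) \<Rightarrow> 'a set set \<Rightarrow> 'a set set \<Rightarrow> ('a set \<times> 'a set) set"
  where "mismatches f g L U = {(x, y). x \<in> L \<and> y \<in> U \<and> x \<subseteq> y \<and> f x \<noteq> g y}"

text \<open>Within one level, \<open>card (x - z) = t\<close> is distance \<open>t\<close> in the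
  Johnson graph. The pairs are ordered, so every unordered pair counts twice.\<close>

definition separated :: "nat \<Rightarrow> ('a set \<Rightarrow> bool) \<Rightarrow> 'a set set \<Rightarrow> ('a set \<times> 'a set) set"
  where "separated t f L = {(x, z). x \<in> L \<and> z \<in> L \<and> card (x - z) = t \<and> f x \<noteq> f z}"

lemma card_Diff_commute:
  assumes "finite x" "finite z" "card x = card z"
  shows "card (z - x) = card (x - z)"
  by (metis assms card_Diff_subset_Int card_Int_Diff diff_add_inverse finite_Int inf_commute)

lemma mismatches_cong:
  "(\<And>x. x \<in> L \<Longrightarrow> f x = f' x) \<Longrightarrow> (\<And>y. y \<in> U \<Longrightarrow> g y = g' y) \<Longrightarrow>
    mismatches f g L U = mismatches f' g' L U"
  by (auto simp: mismatches_def)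

lemma finite_mismatches: "finite L \<Longrightarrow> finite U \<Longrightarrow> finite (mismatches f g L U)"
  by (rule finite_subset[of _ "L \<times> U"]) (auto simp: mismatches_def)

lemma finite_separated: "finite L \<Longrightarrow> finite (separated t f L)"
  by (rule finite_subset[of _ "L \<times> L"]) (auto simp: separated_def)

lemma card_le_by_parameters:
  assumes "finite S" "finite P" "Q \<subseteq> (\<lambda>(s, q). h s q) ` (S \<times> P)"
  shows "card Q \<le> card P * card S"
proof -
  have "card Q \<le> card (S \<times> P)"
    by (rule surj_card_le) (use assms in auto)
  thus ?thesis by (simp add: card_cartesian_product mult.commute)
qed

text \<open>On the path from \<open>x\<close> up to \<open>insert l x\<close>, down to
  \<open>insert l (x \<inter> z)\<close>, up to \<open>insert l z\<close> and down to
  \<open>z\<close>, the labels of the two ends differ, so one of the four edges is a mismatch. A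
  mismatch, its position on the path and two elements of \<open>G\<close> determine
  \<open>x\<close>, \<open>z\<close> and \<open>l\<close>, so each mismatch serves at most
  \<open>4 * (card G)\<^sup>2\<close> triples.\<close>

lemma card_separated_1:
  fixes G :: "'a set"
  assumes G: "finite G" and L: "L \<subseteq> nsets G i" and U: "U \<subseteq> nsets G (Suc i)"
    and m: "\<And>x z. x \<in> L \<Longrightarrow> z \<in> L \<Longrightarrow> card (x - z) = 1 \<Longrightarrow>
      m \<le> card {l \<in> G - (x \<union> z). insert l x \<in> U \<and> insert l z \<in> U \<and> insert l (x \<inter> z) \<in> L}"
  shows "m * card (separated 1 f L) \<le> 4 * (card G)\<^sup>2 * card (mismatches f g L U)"
proof -
  define ok where "ok = (\<lambda>x z. {l \<in> G - (x \<union> z). insert l x \<in> U \<and> insert l z \<in> U \<and> insert l (x \<inter> z) \<in> L})"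
  define M where "M = mismatches f g L U"
  have fL: "finite L" and fU: "finite U"
    using L U G finite_imp_finite_nsets finite_subset by blast+
  hence fM: "finite M" unfolding M_def by (rule finite_mismatches)
  define Q where "Q = (SIGMA p:separated 1 f L. ok (fst p) (snd p))"
  have fok: "finite (ok x z)" for x z using G by (auto simp: ok_def)
  have "m * card (separated 1 f L) \<le> (\<Sum>p\<in>separated 1 f L. card (ok (fst p) (snd p)))"
  proof -
    have "m \<le> card (ok (fst p) (snd p))" if "p \<in> separated 1 f L" for p
      using that unfolding separated_def ok_def by (intro m) auto
    thus ?thesis
      using sum_bounded_below[of "separated 1 f L" m "\<lambda>p. card (ok (fst p) (snd p))"] by (simp add: mult.commute)
  qed
  also have "\<dots> = card Q"
    unfolding Q_def by (rule card_SigmaI[symmetric]) (auto simp: fok fL finite_separated)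
  also have "\<dots> \<le> 4 * (card G)\<^sup>2 * card M"
  proof -
    \<comment> \<open>\<open>h1\<close> to \<open>h4\<close> rebuild \<open>((x, z), l)\<close> from
      the first, second, third and fourth edge of the path. The parameters \<open>a\<close> and
      \<open>b\<close> are the elements of \<open>x - z\<close> and \<open>z - x\<close>.\<close>
    define h1 :: "'a set \<times> 'a set \<Rightarrow> 'a \<times> 'a \<Rightarrow> ('a set \<times> 'a set) \<times> 'a"
      where "h1 = (\<lambda>(u, v) (a, b). ((u, insert b (u - {a})), the_elem (v - u)))" 
    define h2 :: "'a set \<times> 'a set \<Rightarrow> 'a \<times> 'a \<Rightarrow> ('a set \<times> 'a set) \<times> 'a"
      where "h2 = (\<lambda>(u, v) (l, b). ((v - {l}, insert b (u - {l})), l))"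
    define h3 :: "'a set \<times> 'a set \<Rightarrow> 'a \<times> 'a \<Rightarrow> ('a set \<times> 'a set) \<times> 'a"
      where "h3 = (\<lambda>(u, v) (l, a). ((insert a (u - {l}), v - {l}), l))"
    define h4 :: "'a set \<times> 'a set \<Rightarrow> 'a \<times> 'a \<Rightarrow> ('a set \<times> 'a set) \<times> 'a"
      where "h4 = (\<lambda>(u, v) (a, b). ((insert a (u - {b}), u), the_elem (v - u)))"
    define I where "I = (\<lambda>h :: 'a set \<times> 'a set \<Rightarrow> 'a \<times> 'a \<Rightarrow> ('a set \<times> 'a set) \<times> 'a. (\<lambda>(s, q). h s q) ` (M \<times> (G \<times> G)))"
    have I: "h s (a, b) \<in> I h" if "s \<in> M" "a \<in> G" "b \<in> G" for h s a b
      using image_eqI[of "h s (a, b)" "\<lambda>(s, q). h s q" "(s, (a, b))" "M \<times> (G \<times> G)"] that by (simp add: I_def)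
    have "Q \<subseteq> (I h1 \<union> I h2) \<union>
               (I h3 \<union> I h4)"
    proof
      fix q assume "q \<in> Q"
      then obtain x z l where q: "q = ((x, z), l)" and xz: "x \<in> L" "z \<in> L" "card (x - z) = 1" "f x \<noteq> f z"
        and l: "l \<in> G" "l \<notin> x" "l \<notin> z" "insert l x \<in> U" "insert l z \<in> U" "insert l (x \<inter> z) \<in> L"
        by (auto simp: Q_def separated_def ok_def)
      have xG: "x \<subseteq> G" "finite x" "z \<subseteq> G" "finite z" "card x = card z"
        using xz L by (auto simp: nsets_def)
      obtain a where a: "x - z = {a}" using xz by (meson card_1_singletonE)
      obtain b where b: "z - x = {b}"
        using card_Diff_commute[OF xG(2,4,5)] xz by (metis card_1_singletonE)
      have ab: "a \<in> G" "b \<in> G" using a b xG by auto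
      have zx: "z = insert b (x - {a})" "x = insert a (z - {b})" using a b by auto
      consider "(x, insert l x) \<in> M" | "(insert l (x \<inter> z), insert l x) \<in> M"
        | "(insert l (x \<inter> z), insert l z) \<in> M" | "(z, insert l z) \<in> M"
        using xz l unfolding M_def mismatches_def by auto
      thus "q \<in> (I h1 \<union> I h2) \<union>
               (I h3 \<union> I h4)"
      proof cases
        case 1
        have "insert l x - x = {l}" using l by auto
        hence "q = h1 (x, insert l x) (a, b)" using zx(1) q by (simp add: h1_def)
        moreover have "\<dots> \<in> I h1" using 1 ab l by (intro I) auto
        ultimately show ?thesis by simp
      next
        case 2
        have "insert b (insert l (x \<inter> z) - {l}) = z" "insert l x - {l} = x" using l a b by auto
        hence "q = h2 (insert l (x \<inter> z), insert l x) (l, b)" using q by (simp add: h2_def)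
        moreover have "\<dots> \<in> I h2" using 2 ab l by (intro I) auto
        ultimately show ?thesis by simp
      next
        case 3
        have "insert a (insert l (x \<inter> z) - {l}) = x" "insert l z - {l} = z" using l a b by auto
        hence "q = h3 (insert l (x \<inter> z), insert l z) (l, a)" using q by (simp add: h3_def)
        moreover have "\<dots> \<in> I h3" using 3 ab l by (intro I) auto
        ultimately show ?thesis by simp
      next
        case 4
        have "insert l z - z = {l}" using l by auto
        hence "q = h4 (z, insert l z) (a, b)" using zx(2) q by (simp add: h4_def)
        moreover have "\<dots> \<in> I h4" using 4 ab l by (intro I) auto
        ultimately show ?thesis by simp
      qed
    qed
    moreover have "card (I h) \<le> (card G)\<^sup>2 * card M" for h :: "_ \<Rightarrow> _ \<Rightarrow> ('a set \<times> 'a set) \<times> 'a"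
      using card_le_by_parameters[of M "G \<times> G" "I h" h] fM G
      by (simp add: I_def card_cartesian_product power2_eq_square)
    moreover have fin: "finite (I h)" for h :: "_ \<Rightarrow> _ \<Rightarrow> ('a set \<times> 'a set) \<times> 'a"
      using fM G by (simp add: I_def)
    ultimately have "card Q \<le> ((card G)\<^sup>2 * card M + (card G)\<^sup>2 * card M) + ((card G)\<^sup>2 * card M + (card G)\<^sup>2 * card M)"
      by (meson add_mono card_Un_le card_mono finite_UnI order_trans)
    thus ?thesis by simp
  qed
  finally show ?thesis unfolding M_def .
qed


lemma card_nsets_Int_Un:
  assumes "finite G" "x \<in> nsets G i" "z \<in> nsets G i" "card (x - z) = t"
  shows "card (x \<inter> z) = i - t" "card (G - (x \<union> z)) = card G - i - t" "card (z - x) = t"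
proof -
  have f: "finite x" "finite z" "card x = i" "card z = i" "x \<subseteq> G" "z \<subseteq> G" using assms by (auto simp: nsets_def)
  show c: "card (z - x) = t" using card_Diff_commute[of x z] f assms by simp
  show "card (x \<inter> z) = i - t" using card_Int_Diff[of x z] f assms by simp
  have "x \<union> z = z \<union> (x - z)" by auto
  hence "card (x \<union> z) = i + t" using f assms by (subst \<open>x \<union> z = _\<close>, subst card_Un_disjoint) auto
  thus "card (G - (x \<union> z)) = card G - i - t" using f assms by (subst card_Diff_subset) auto
qed

lemma card_nsets_at_distance:
  assumes G: "finite G" and z: "z \<in> nsets G i"
  shows "card {x \<in> nsets G i. card (x - z) = t} = (i choose t) * ((card G - i) choose t)"
proof -
  have zf: "z \<subseteq> G" "finite z" "card z = i" using z by (auto simp: nsets_def)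
  have "bij_betw (\<lambda>x. (z - x, x - z)) {x \<in> nsets G i. card (x - z) = t} (nsets z t \<times> nsets (G - z) t)"
  proof (rule bij_betwI[where g = "\<lambda>(p, q). (z - p) \<union> q"])
    show "(\<lambda>x. (z - x, x - z)) \<in> {x \<in> nsets G i. card (x - z) = t} \<rightarrow> nsets z t \<times> nsets (G - z) t"
      using card_nsets_Int_Un(3)[OF G _ z] zf G by (auto simp: nsets_def finite_subset)
    show "(\<lambda>(p, q). (z - p) \<union> q) \<in> nsets z t \<times> nsets (G - z) t \<rightarrow> {x \<in> nsets G i. card (x - z) = t}"
    proof (safe, goal_cases)
      case (1 p q)
      hence pq: "p \<subseteq> z" "q \<subseteq> G - z" "finite p" "finite q" "card p = t" "card q = t" by (auto simp: nsets_def)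
      have "card p \<le> card z" using pq zf by (intro card_mono) auto
      moreover have "card (z - p \<union> q) = card (z - p) + card q" using pq zf by (intro card_Un_disjoint) auto
      moreover have "card (z - p) = i - t" using pq zf by (simp add: card_Diff_subset)
      ultimately show ?case using pq zf by (auto simp: nsets_def)
    next
      case (2 p q)
      hence "z - p \<union> q - z = q" by (auto simp: nsets_def)
      thus ?case using 2 by (auto simp: nsets_def)
    qed
  qed (auto simp: nsets_def)
  from bij_betw_same_card[OF this] show ?thesis
    using zf G by (simp add: card_cartesian_product card_Diff_subset)
qed

text \<open>A pair \<open>(x, z)\<close> at distance \<open>Suc t\<close> has at least
  \<open>(Suc t)\<^sup>2\<close> sets \<open>w\<close> at distance \<open>t\<close> from
  \<open>x\<close> and 1 from \<open>z\<close>: an element of \<open>x - z\<close> is put into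
  \<open>z\<close> and one of \<open>z - x\<close> is removed. As \<open>f\<close> changes between
  \<open>x\<close> and \<open>w\<close> or between \<open>w\<close> and \<open>z\<close>, the triple
  is charged to that closer pair; the coefficients on the right bound the number of triples charged
  to one pair.\<close>

lemma card_separated_Suc:
  assumes G: "finite G" and i: "L = nsets G i"
  shows "(Suc t)\<^sup>2 * card (separated (Suc t) f L) \<le>
    (i - t) * (card G - i - t) * card (separated t f L) +
    ((i - 1) choose t) * ((card G - i - 1) choose t) * card (separated 1 f L)"
proof -
  have fL: "finite L" using G i finite_imp_finite_nsets by blast
  define F where "F = (\<lambda>(x, z). {w \<in> L. card (x - w) = t \<and> card (w - z) = 1})"
  define F1 where "F1 = (\<lambda>(x, w). {z \<in> L. card (w - z) = 1 \<and> card (x - z) = Suc t})"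
  define F2 where "F2 = (\<lambda>(w, z). {x \<in> L. card (x - w) = t \<and> card (x - z) = Suc t})"
  have L_D: "x \<subseteq> G" "finite x" "card x = i" if "x \<in> L" for x using that i by (auto simp: nsets_def)
  have "(Suc t)\<^sup>2 * card (separated (Suc t) f L) \<le> (\<Sum>p\<in>separated (Suc t) f L. card (F p))"
  proof -
    have "(Suc t)\<^sup>2 \<le> card (F p)" if "p \<in> separated (Suc t) f L" for p
    proof -
      obtain x z where p: "p = (x, z)" by fastforce
      have xz: "x \<in> L" "z \<in> L" "card (x - z) = Suc t" using that p by (auto simp: separated_def)
      hence c: "card (z - x) = Suc t" using card_nsets_Int_Un(3)[OF G] i by blast
      have "card ((x - z) \<times> (z - x)) \<le> card (F (x, z))"
      proof (rule card_inj_on_le[where f = "\<lambda>(a, b). insert a (z - {b})"])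
        show "inj_on (\<lambda>(a, b). insert a (z - {b})) ((x - z) \<times> (z - x))"
        proof (rule inj_onI, clarsimp, goal_cases)
          case (1 a b a' b')
          have "insert a (z - {b}) - z = {a}" "insert a' (z - {b'}) - z = {a'}"
               "z - insert a (z - {b}) = {b}" "z - insert a' (z - {b'}) = {b'}" using 1 by auto
          thus ?case using 1 by (metis singleton_inject)
        qed
        show "(\<lambda>(a, b). insert a (z - {b})) ` ((x - z) \<times> (z - x)) \<subseteq> F (x, z)"
        proof clarify
          fix a b assume ab: "a \<in> x" "a \<notin> z" "b \<in> z" "b \<notin> x"
          let ?w = "insert a (z - {b})"
          have "x - ?w = (x - z) - {a}" using ab by auto
          hence 1: "card (x - ?w) = t" using ab L_D[OF xz(1)] xz(3) by simp
          have "?w - z = {a}" using ab by auto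
          hence 2: "card (?w - z) = 1" by simp
          have "card ?w = i" using ab L_D[OF xz(2)] card_Suc_Diff1[of z b]
            by (simp add: card_insert_if)
          hence "?w \<in> L" using ab L_D[OF xz(1)] L_D[OF xz(2)] unfolding i by (auto simp: nsets_def)
          with 1 2 show "?w \<in> F (x, z)" by (simp add: F_def)
        qed
        show "finite (F (x, z))" using fL by (auto simp: F_def)
      qed
      thus ?thesis using xz c p by (simp add: card_cartesian_product power2_eq_square)
    qed
    thus ?thesis
      using sum_bounded_below[of "separated (Suc t) f L" "(Suc t)\<^sup>2" "\<lambda>p. card (F p)"] by (simp add: mult.commute)
  qed
  also have "\<dots> = card (SIGMA p:separated (Suc t) f L. F p)"
    using fL by (intro card_SigmaI[symmetric]) (auto simp: finite_separated F_def)
  also have "\<dots> \<le> card ((\<lambda>((x, w), z). ((x, z), w)) ` (SIGMA p:separated t f L. F1 p) \<union>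
                       (\<lambda>((w, z), x). ((x, z), w)) ` (SIGMA p:separated 1 f L. F2 p))"
  proof (rule card_mono)
    show "finite ((\<lambda>((x, w), z). ((x, z), w)) ` (SIGMA p:separated t f L. F1 p) \<union>
                       (\<lambda>((w, z), x). ((x, z), w)) ` (SIGMA p:separated 1 f L. F2 p))"
      using fL by (intro finite_UnI finite_imageI finite_SigmaI) (auto simp: finite_separated F1_def F2_def)
    show "(SIGMA p:separated (Suc t) f L. F p) \<subseteq> (\<lambda>((x, w), z). ((x, z), w)) ` (SIGMA p:separated t f L. F1 p) \<union>
                       (\<lambda>((w, z), x). ((x, z), w)) ` (SIGMA p:separated 1 f L. F2 p)"
    proof
      fix q assume "q \<in> (SIGMA p:separated (Suc t) f L. F p)"
      then obtain x z w where q: "q = ((x, z), w)" and *: "x \<in> L" "z \<in> L" "card (x - z) = Suc t" "f x \<noteq> f z"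
         "w \<in> L" "card (x - w) = t" "card (w - z) = 1"
        by (auto simp: separated_def F_def)
      show "q \<in> (\<lambda>((x, w), z). ((x, z), w)) ` (SIGMA p:separated t f L. F1 p) \<union>
                       (\<lambda>((w, z), x). ((x, z), w)) ` (SIGMA p:separated 1 f L. F2 p)"
      proof (cases "f x = f w")
        case True
        hence "((w, z), x) \<in> (SIGMA p:separated 1 f L. F2 p)" using * by (auto simp: separated_def F2_def)
        thus ?thesis using q by force
      next
        case False
        hence "((x, w), z) \<in> (SIGMA p:separated t f L. F1 p)" using * by (auto simp: separated_def F1_def)
        thus ?thesis using q by force
      qed
    qed
  qed
  also have "\<dots> \<le> card (SIGMA p:separated t f L. F1 p) + card (SIGMA p:separated 1 f L. F2 p)"
    by (rule order_trans[OF card_Un_le add_mono]; intro card_image_le)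
       (use fL in \<open>auto simp: finite_separated F1_def F2_def\<close>)
  also have "\<dots> = (\<Sum>p\<in>separated t f L. card (F1 p)) + (\<Sum>p\<in>separated 1 f L. card (F2 p))"
    using fL by (intro arg_cong2[where f = "(+)"] card_SigmaI) (auto simp: finite_separated F1_def F2_def)
  also have "\<dots> \<le> (i - t) * (card G - i - t) * card (separated t f L) +
    ((i - 1) choose t) * ((card G - i - 1) choose t) * card (separated 1 f L)"
  proof (rule add_mono)
    have "card (F1 p) \<le> (i - t) * (card G - i - t)" if "p \<in> separated t f L" for p
    proof -
      obtain x w where p: "p = (x, w)" by fastforce
      have xw: "x \<in> L" "w \<in> L" "card (x - w) = t" using that p by (auto simp: separated_def)
      have "F1 (x, w) \<subseteq> (\<lambda>(p, q). insert q (w - {p})) ` ((x \<inter> w) \<times> (G - (x \<union> w)))"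
      proof
        fix z assume "z \<in> F1 (x, w)"
        hence z: "z \<in> L" "card (w - z) = 1" "card (x - z) = Suc t" by (auto simp: F1_def)
        obtain p where pp: "w - z = {p}" using z by (meson card_1_singletonE)
        obtain q where qq: "z - w = {q}"
          using card_nsets_Int_Un(3)[OF G, of w i z 1] i z xw by (metis card_1_singletonE)
        have fx: "finite (x - w)" using xw L_D by simp
        have "p \<in> x"
        proof (rule ccontr)
          assume "p \<notin> x"
          hence "x - z \<subseteq> x - w" using pp by auto
          from card_mono[OF fx this] show False using z xw by simp
        qed
        moreover have "q \<notin> x"
        proof
          assume "q \<in> x"
          have "x - z \<subseteq> insert p ((x - w) - {q})" using pp qq by auto
          hence "card (x - z) \<le> card (insert p ((x - w) - {q}))" using fx by (intro card_mono) auto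
          also have "\<dots> \<le> Suc (card ((x - w) - {q}))" using fx by (simp add: card_insert_if)
          also have "\<dots> = card (x - w)" using \<open>q \<in> x\<close> qq by (intro card_Suc_Diff1 fx) auto
          finally show False using z xw by simp
        qed
        moreover have "z = insert q (w - {p})" using pp qq by auto
        moreover have "q \<in> G" "p \<in> w" "q \<notin> w" using pp qq L_D[OF z(1)] by auto
        ultimately show "z \<in> (\<lambda>(p, q). insert q (w - {p})) ` ((x \<inter> w) \<times> (G - (x \<union> w)))" by force
      qed
      from surj_card_le[OF _ this] have "card (F1 (x, w)) \<le> card ((x \<inter> w) \<times> (G - (x \<union> w)))"
        using G xw L_D by simp
      thus ?thesis using card_nsets_Int_Un(1,2)[OF G, of x i w t] xw i p by (simp add: card_cartesian_product)
    qed
    thus "(\<Sum>p\<in>separated t f L. card (F1 p)) \<le> (i - t) * (card G - i - t) * card (separated t f L)"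
      using sum_bounded_above[of "separated t f L" "\<lambda>p. card (F1 p)" "(i - t) * (card G - i - t)"]
      by (simp only: of_nat_id mult.commute)
  next
    have "card (F2 p) \<le> ((i - 1) choose t) * ((card G - i - 1) choose t)" if "p \<in> separated 1 f L" for p
    proof -
      obtain w z where p: "p = (w, z)" by fastforce
      have wz: "w \<in> L" "z \<in> L" "card (w - z) = 1" using that p by (auto simp: separated_def)
      obtain p where pp: "w - z = {p}" using wz by (meson card_1_singletonE)
      obtain q where qq: "z - w = {q}"
        using card_nsets_Int_Un(3)[OF G, of w i z 1] i wz by (metis card_1_singletonE)
      \<comment> \<open>A set \<open>x\<close> at distance \<open>t\<close> from \<open>w\<close>
        and \<open>Suc t\<close> from \<open>z\<close> contains \<open>p\<close> and avoids
        \<open>q\<close>, so one element fewer is available on each side.\<close>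
      have "card (F2 (w, z)) \<le> card (nsets (w - {p}) t \<times> nsets (G - w - {q}) t)"
      proof (rule card_inj_on_le[where f = "\<lambda>x. (w - x, x - w)"])
        show "inj_on (\<lambda>x. (w - x, x - w)) (F2 (w, z))" by (rule inj_onI) auto
        show "finite (nsets (w - {p}) t \<times> nsets (G - w - {q}) t)"
          using G wz L_D by (intro finite_cartesian_product finite_imp_finite_nsets) auto
        show "(\<lambda>x. (w - x, x - w)) ` F2 (w, z) \<subseteq> nsets (w - {p}) t \<times> nsets (G - w - {q}) t"
        proof
          fix u assume "u \<in> (\<lambda>x. (w - x, x - w)) ` F2 (w, z)"
          then obtain x where x: "u = (w - x, x - w)" "x \<in> L" "card (x - w) = t" "card (x - z) = Suc t"
            by (auto simp: F2_def)
          have fx: "finite (x - w)" using x L_D by simp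
          have "p \<in> x"
          proof (rule ccontr)
            assume "p \<notin> x"
            hence "x - z \<subseteq> x - w" using pp by auto
            from card_mono[OF fx this] show False using x by simp
          qed
          moreover have "q \<notin> x"
          proof
            assume "q \<in> x"
            have "x - z \<subseteq> insert p ((x - w) - {q})" using pp qq by auto
            hence "card (x - z) \<le> card (insert p ((x - w) - {q}))" using fx by (intro card_mono) auto
          also have "\<dots> \<le> Suc (card ((x - w) - {q}))" using fx by (simp add: card_insert_if)
            also have "\<dots> = card (x - w)" using \<open>q \<in> x\<close> qq by (intro card_Suc_Diff1 fx) auto
            finally show False using x by simp
          qed
          moreover have "card (w - x) = t" using card_nsets_Int_Un(3)[OF G, of x i w t] x wz i by simp
          ultimately show "u \<in> nsets (w - {p}) t \<times> nsets (G - w - {q}) t"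
            using x fx L_D[OF x(2)] L_D[OF wz(1)] by (auto simp: nsets_def)
        qed
      qed
      moreover have "card (w - {p}) = i - 1" "card (G - w - {q}) = card G - i - 1"
        using pp qq wz L_D[of w] L_D[of z] G by (auto simp: card_Diff_subset card_Diff_singleton_if)
      ultimately show ?thesis using p by (simp add: card_cartesian_product)
    qed
    thus "(\<Sum>p\<in>separated 1 f L. card (F2 p)) \<le> ((i - 1) choose t) * ((card G - i - 1) choose t) * card (separated 1 f L)"
      using sum_bounded_above[of "separated 1 f L" "\<lambda>p. card (F2 p)" "((i - 1) choose t) * ((card G - i - 1) choose t)"]
      by (simp only: of_nat_id mult.commute)
  qed
  finally show ?thesis .
qed

text \<open>Each of the \<open>t\<close> steps of a geodesic may be the one where \<open>f\<close>
  changes. Iterating \<open>card_separated_Suc\<close> and dividing by the number of all ordered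
  pairs at each distance, the proportion of separated pairs at distance \<open>t\<close> is at most
  \<open>t\<close> times the proportion at distance 1.\<close>

lemma card_separated_le:
  assumes G: "finite G" and L: "L = nsets G i"
  shows "card (separated t f L) * (i * (card G - i)) \<le>
         t * ((i choose t) * ((card G - i) choose t)) * card (separated 1 f L)"
proof (induction t)
  case 0
  have "x = z" if "x \<in> L" "z \<in> L" "card (x - z) = 0" for x z
    using that card_subset_eq[of z x] by (auto simp: L nsets_def)
  hence "separated 0 f L = {}" by (auto simp: separated_def)
  thus ?case by simp
next
  case (Suc t)
  let ?n = "card G - i" and ?W = "\<lambda>t. card (separated t f L)"
  have e1: "(i - t) * (i choose t) = Suc t * (i choose Suc t)" "(?n - t) * (?n choose t) = Suc t * (?n choose Suc t)"
    by (metis binomial_absorb_comp times_binomial_minus1_eq zero_less_Suc diff_Suc_1)+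
  have e2: "i * ((i - 1) choose t) = Suc t * (i choose Suc t)" "?n * ((?n - 1) choose t) = Suc t * (?n choose Suc t)"
    by (metis times_binomial_minus1_eq zero_less_Suc diff_Suc_1)+
  have "(Suc t)\<^sup>2 * (?W (Suc t) * (i * ?n)) = ((Suc t)\<^sup>2 * ?W (Suc t)) * (i * ?n)" by simp
  also have "\<dots> \<le> ((i - t) * (?n - t) * ?W t + ((i - 1) choose t) * ((?n - 1) choose t) * ?W 1) * (i * ?n)"
    using card_separated_Suc[OF G L, of t f] by (intro mult_right_mono) auto
  also have "\<dots> = (i - t) * (?n - t) * (?W t * (i * ?n)) + (i * ((i - 1) choose t)) * (?n * ((?n - 1) choose t)) * ?W 1"
    by (simp only: distrib_right distrib_left mult_ac)
  also have "\<dots> \<le> (i - t) * (?n - t) * (t * ((i choose t) * (?n choose t)) * ?W 1) + (i * ((i - 1) choose t)) * (?n * ((?n - 1) choose t)) * ?W 1"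
    using Suc by (intro add_mono mult_left_mono) auto
  also have "\<dots> = ((i - t) * (i choose t)) * ((?n - t) * (?n choose t)) * t * ?W 1 + (i * ((i - 1) choose t)) * (?n * ((?n - 1) choose t)) * ?W 1"
    by (simp only: mult_ac)
  also have "\<dots> = (Suc t)\<^sup>2 * (Suc t * ((i choose Suc t) * (?n choose Suc t)) * ?W 1)"
    unfolding e1 e2 power2_eq_square Suc_eq_plus1[of t] by (simp only: distrib_right distrib_left mult_ac mult_1 mult_1_right add_ac)
  finally show ?case by (subst (asm) nat_mult_le_cancel1) auto
qed

text \<open>A pair with one member in each part is separated at some distance
  \<open>t \<le> i\<close>. All distances are reduced to distance 1 by
  \<open>card_separated_le\<close>, with the factor \<open>t\<close> bounded by \<open>i\<close>;
  Vandermonde's identity sums the binomial products to \<open>card L\<close>, and the factor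
  \<open>i\<close> cancels.\<close>

lemma Johnson_isoperimetry:
  assumes G: "finite G" and L: "L = nsets G i" and i: "0 < i" "i \<le> card G"
  shows "2 * card {x \<in> L. f x} * card {x \<in> L. \<not> f x} * (card G - i) \<le> card (separated 1 f L) * card L"
proof -
  let ?n = "card G - i" and ?A = "{x \<in> L. f x}" and ?B = "{x \<in> L. \<not> f x}"
  have fL: "finite L" using G L finite_imp_finite_nsets by blast
  have "2 * card ?A * card ?B = card (?A \<times> ?B \<union> ?B \<times> ?A)"
    using fL by (subst card_Un_disjoint) (auto simp: card_cartesian_product)
  also have "\<dots> \<le> card (\<Union>t\<in>{..i}. separated t f L)"
  proof (rule card_mono)
    have "card (x - z) \<le> i" if "x \<in> L" for x z
      using that L card_mono[of x "x - z"] by (auto simp: nsets_def)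
    thus "?A \<times> ?B \<union> ?B \<times> ?A \<subseteq> (\<Union>t\<in>{..i}. separated t f L)" by (auto simp: separated_def)
  qed (use fL in \<open>simp add: finite_separated\<close>)
  also have "\<dots> \<le> (\<Sum>t\<le>i. card (separated t f L))" by (rule card_UN_le) simp
  finally have "2 * card ?A * card ?B * (i * ?n) \<le> (\<Sum>t\<le>i. card (separated t f L)) * (i * ?n)"
    by (rule mult_right_mono) simp
  also have "\<dots> = (\<Sum>t\<le>i. card (separated t f L) * (i * ?n))" by (rule sum_distrib_right)
  also have "\<dots> \<le> (\<Sum>t\<le>i. i * card (separated 1 f L) * ((?n choose t) * (i choose (i - t))))"
  proof (rule sum_mono)
    fix t assume "t \<in> {..i}"
    hence "(i choose (i - t)) = (i choose t)" by (simp add: binomial_symmetric[symmetric])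
    have "card (separated t f L) * (i * ?n) \<le> t * ((i choose t) * (?n choose t)) * card (separated 1 f L)"
      by (rule card_separated_le[OF G L])
    also have "\<dots> \<le> i * ((i choose t) * (?n choose t)) * card (separated 1 f L)"
      using \<open>t \<in> _\<close> by (intro mult_right_mono) auto
    also have "\<dots> = i * card (separated 1 f L) * ((?n choose t) * (i choose (i - t)))"
      unfolding \<open>(i choose (i - t)) = _\<close> by (simp only: mult_ac)
    finally show "card (separated t f L) * (i * ?n) \<le> i * card (separated 1 f L) * ((?n choose t) * (i choose (i - t)))" .
  qed
  also have "\<dots> = i * card (separated 1 f L) * card L"
    unfolding sum_distrib_left[symmetric] vandermonde using L i by simp
  finally have "i * (2 * card ?A * card ?B * ?n) \<le> i * (card (separated 1 f L) * card L)" by (simp only: mult_ac)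
  thus ?thesis using nat_mult_le_cancel1[OF i(1)] by blast
qed


section \<open>Complementation of the cube\<close>

lemma inj_on_compl: "A \<subseteq> Pow G \<Longrightarrow> inj_on ((-) G) A"
  by (rule inj_onI) (metis Pow_iff double_diff subsetD order_refl)

lemma compl_mem_image_iff: "X \<subseteq> Pow G \<Longrightarrow> v \<subseteq> G \<Longrightarrow> v \<in> (-) G ` X \<longleftrightarrow> G - v \<in> X"
  by (auto simp: image_iff double_diff)

lemma compl_nsets: "finite G \<Longrightarrow> v \<subseteq> G \<Longrightarrow> i \<le> card G \<Longrightarrow> G - v \<in> nsets G (card G - i) \<longleftrightarrow> v \<in> nsets G i"
  using card_mono[of G v] by (auto simp: nsets_def card_Diff_subset finite_subset)

lemma card_mismatches_compl:
  assumes "L \<subseteq> Pow G" "U \<subseteq> Pow G"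
  shows "card (mismatches (\<lambda>y. g (G - y)) (\<lambda>x. f (G - x)) ((-) G ` U) ((-) G ` L)) = card (mismatches f g L U)"
proof (rule bij_betw_same_card[symmetric])
  show "bij_betw (\<lambda>(x, y). (G - y, G - x)) (mismatches f g L U)
     (mismatches (\<lambda>y. g (G - y)) (\<lambda>x. f (G - x)) ((-) G ` U) ((-) G ` L))"
    by (rule bij_betwI[where g = "\<lambda>(x, y). (G - y, G - x)"])
       (use assms in \<open>auto simp: mismatches_def double_diff subset_iff\<close>)
qed

lemma card_separated_compl:
  assumes "finite G" "L \<subseteq> nsets G i"
  shows "card (separated t (\<lambda>x. f (G - x)) ((-) G ` L)) = card (separated t f L)"
proof (rule bij_betw_same_card[symmetric])
  have LG: "x \<subseteq> G" if "x \<in> L" for x using that assms by (auto simp: nsets_def)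
  have 1: "card (G - x - (G - z)) = card (x - z)" if "x \<in> L" "z \<in> L" for x z
  proof -
    have "G - x - (G - z) = z - x" using LG[OF that(2)] by auto
    thus ?thesis using card_nsets_Int_Un(3)[OF assms(1)] that assms by (metis subsetD)
  qed
  show "bij_betw (\<lambda>(x, y). (G - x, G - y)) (separated t f L) (separated t (\<lambda>x. f (G - x)) ((-) G ` L))"
    by (rule bij_betwI[where g = "\<lambda>(x, y). (G - x, G - y)"])
       (use LG in \<open>auto simp: separated_def double_diff 1\<close>)
qed

text \<open>Complementation reverses inclusion and takes level \<open>Suc i\<close> to level
  \<open>card G - Suc i\<close>, so this is \<open>card_separated_1\<close> for the complemented
  levels, with paths going down first.\<close>

lemma card_separated_1_dual:
  assumes G: "finite G" and L: "L \<subseteq> nsets G i" and U: "U \<subseteq> nsets G (Suc i)"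
    and m: "\<And>x z. x \<in> U \<Longrightarrow> z \<in> U \<Longrightarrow> card (x - z) = 1 \<Longrightarrow>
      m \<le> card {l \<in> x \<inter> z. x - {l} \<in> L \<and> z - {l} \<in> L \<and> (x \<union> z) - {l} \<in> U}"
  shows "m * card (separated 1 g U) \<le> 4 * (card G)\<^sup>2 * card (mismatches f g L U)"
\<comment> \<open>A nonempty \<open>U\<close> forces \<open>Suc i \<le> card G\<close>, so that the
  difference \<open>card G - Suc i\<close> is not truncated.\<close>
proof (cases "U = {}")
  case False
  then obtain u where "u \<in> U" by auto
  hence i: "Suc i \<le> card G" using U G card_mono[of G u] by (auto simp: nsets_def)
  have LU: "L \<subseteq> Pow G" "U \<subseteq> Pow G" using L U by (auto simp: nsets_def)
  have "m * card (separated 1 (\<lambda>y. g (G - y)) ((-) G ` U)) \<le>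
        4 * (card G)\<^sup>2 * card (mismatches (\<lambda>y. g (G - y)) (\<lambda>x. f (G - x)) ((-) G ` U) ((-) G ` L))"
  proof (rule card_separated_1[OF G, where i = "card G - Suc i"])
    show "(-) G ` U \<subseteq> nsets G (card G - Suc i)" using compl_nsets[OF G _ i] U LU by (intro image_subsetI) blast
    show "(-) G ` L \<subseteq> nsets G (Suc (card G - Suc i))"
      using compl_nsets[OF G, of _ i] L LU i by (auto simp: Suc_diff_Suc)
    fix x z assume xz: "x \<in> (-) G ` U" "z \<in> (-) G ` U" "card (x - z) = 1"
    then obtain x' z' where x': "x' \<in> U" "z' \<in> U" "x = G - x'" "z = G - z'" by auto
    have xG: "x' \<subseteq> G" "z' \<subseteq> G" using x' LU by auto
    have "x - z = z' - x'" using x' xG by auto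
    hence c: "card (x' - z') = 1"
      using xz card_nsets_Int_Un(3)[OF G, of z' "Suc i" x' 1] x' U by auto
    have "{l \<in> x' \<inter> z'. x' - {l} \<in> L \<and> z' - {l} \<in> L \<and> (x' \<union> z') - {l} \<in> U} \<subseteq>
      {l \<in> G - (x \<union> z). insert l x \<in> (-) G ` L \<and> insert l z \<in> (-) G ` L \<and> insert l (x \<inter> z) \<in> (-) G ` U}"
    proof clarify
      fix l assume l: "l \<in> x'" "l \<in> z'" "x' - {l} \<in> L" "z' - {l} \<in> L" "(x' \<union> z') - {l} \<in> U"
      have "insert l x = G - (x' - {l})" "insert l z = G - (z' - {l})" "insert l (x \<inter> z) = G - ((x' \<union> z') - {l})"
        using l x' xG by auto
      thus "l \<in> G - (x \<union> z) \<and> insert l x \<in> (-) G ` L \<and> insert l z \<in> (-) G ` L \<and> insert l (x \<inter> z) \<in> (-) G ` U"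
        using l x' xG by auto
    qed
    from card_mono[OF _ this] m[OF x'(1,2) c] G
    show "m \<le> card {l \<in> G - (x \<union> z). insert l x \<in> (-) G ` L \<and> insert l z \<in> (-) G ` L \<and> insert l (x \<inter> z) \<in> (-) G ` U}"
      by simp
  qed
  thus ?thesis
    using card_separated_compl[OF G U, of 1 g] card_mismatches_compl[OF LU, of g f] by simp
qed (simp add: separated_def)

section \<open>Neighbours in adjacent levels\<close>

lemma card_covers:
  assumes "finite G" "x \<in> nsets G i" "Y \<subseteq> nsets G (Suc i)"
  shows "card {y \<in> Y. x \<subseteq> y} = card {l \<in> G - x. insert l x \<in> Y}"
proof (rule bij_betw_same_card[symmetric])
  have "\<exists>l\<in>G - x. y = insert l x" if "y \<in> Y" "x \<subseteq> y" for y
  proof -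
    have y: "y \<subseteq> G" "finite y" "card y = Suc i" using that assms by (auto simp: nsets_def)
    have "card (y - x) = 1" using y that assms by (subst card_Diff_subset) (auto simp: nsets_def)
    then obtain l where "y - x = {l}" by (meson card_1_singletonE)
    thus ?thesis using that y by (intro bexI[of _ l]) auto
  qed
  thus "bij_betw (\<lambda>l. insert l x) {l \<in> G - x. insert l x \<in> Y} {y \<in> Y. x \<subseteq> y}"
    unfolding bij_betw_def
  proof (intro conjI)
    show "inj_on (\<lambda>l. insert l x) {l \<in> G - x. insert l x \<in> Y}" by (rule inj_onI) blast
    show "(\<lambda>l. insert l x) ` {l \<in> G - x. insert l x \<in> Y} = {y \<in> Y. x \<subseteq> y}"
    proof (intro equalityI subsetI)
      fix y assume "y \<in> {y \<in> Y. x \<subseteq> y}"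
      moreover from this obtain l where "l \<in> G - x" "y = insert l x"
        using \<open>\<And>y. y \<in> Y \<Longrightarrow> x \<subseteq> y \<Longrightarrow> \<exists>l\<in>G - x. y = insert l x\<close> by blast
      ultimately show "y \<in> (\<lambda>l. insert l x) ` {l \<in> G - x. insert l x \<in> Y}" by simp
    qed auto
  qed
qed

lemma card_covered:
  assumes "finite G" "y \<in> nsets G (Suc i)" "Y \<subseteq> nsets G i"
  shows "card {x \<in> Y. x \<subseteq> y} = card {l \<in> y. y - {l} \<in> Y}"
proof (rule bij_betw_same_card[symmetric])
  have y: "y \<subseteq> G" "finite y" "card y = Suc i" using assms by (auto simp: nsets_def)
  have "\<exists>l\<in>y. x = y - {l}" if "x \<in> Y" "x \<subseteq> y" for x
  proof -
    have "card (y - x) = 1" using y that assms by (subst card_Diff_subset) (auto simp: nsets_def)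
    then obtain l where "y - x = {l}" by (meson card_1_singletonE)
    thus ?thesis using that y by (intro bexI[of _ l]) auto
  qed
  thus "bij_betw (\<lambda>l. y - {l}) {l \<in> y. y - {l} \<in> Y} {x \<in> Y. x \<subseteq> y}"
    unfolding bij_betw_def
  proof (intro conjI)
    show "inj_on (\<lambda>l. y - {l}) {l \<in> y. y - {l} \<in> Y}" by (rule inj_onI) blast
    show "(\<lambda>l. y - {l}) ` {l \<in> y. y - {l} \<in> Y} = {x \<in> Y. x \<subseteq> y}"
    proof (intro equalityI subsetI)
      fix x assume "x \<in> {x \<in> Y. x \<subseteq> y}"
      moreover from this obtain l where "l \<in> y" "x = y - {l}"
        using \<open>\<And>x. x \<in> Y \<Longrightarrow> x \<subseteq> y \<Longrightarrow> \<exists>l\<in>y. x = y - {l}\<close> by blast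
      ultimately show "x \<in> (\<lambda>l. y - {l}) ` {l \<in> y. y - {l} \<in> Y}" by simp
    qed auto
  qed
qed
lemma card_le_Un4:
  assumes "finite T" "finite A" "finite B" "finite C" "S \<subseteq> T \<union> A \<union> B \<union> C"
  shows "card S \<le> card T + card A + card B + card C"
proof -
  have "card S \<le> card (T \<union> A \<union> B \<union> C)" using assms by (intro card_mono) auto
  also have "\<dots> \<le> card T + card A + card B + card C"
    by (intro order_trans[OF card_Un_le] add_mono order_refl)
  finally show ?thesis .
qed

lemma antichain_iff: "antichain F \<longleftrightarrow> (\<forall>u\<in>F. \<forall>v\<in>F. u \<subseteq> v \<longrightarrow> u = v)"
  unfolding antichain_def pairwise_def by blast

definition up_shadow :: "'a set set \<Rightarrow> 'a set set \<Rightarrow> 'a set set"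
  where "up_shadow U A = {y \<in> U. \<exists>x\<in>A. x \<subseteq> y}"

section \<open>Typical families\<close>

definition up_degree :: "'a set \<Rightarrow> 'a set set \<Rightarrow> 'a set \<Rightarrow> nat"
  where "up_degree G X x = card {l \<in> G - x. insert l x \<in> X}"

definition down_degree :: "'a set set \<Rightarrow> 'a set \<Rightarrow> nat"
  where "down_degree X y = card {l \<in> y. y - {l} \<in> X}"

text \<open>The bounds on missing neighbours concern all \<open>v\<close>, present or not. The
  averages are taken at distance 2, where for these levels there are
  \<open>M = (i choose 2) * ((n - i) choose 2)\<close> sets, of order \<open>n^4\<close>:
  Hoeffding's exponent is of order \<open>M / n^2\<close>, hence \<open>n^2\<close>, and survives a
  union over all \<open>z\<close>. At distance 1 the same bound would have a bounded exponent. The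
  two ranges of levels correspond under \<open>j = n - i\<close>, and the shift by 3 makes the range
  of \<open>i\<close> invariant under replacing \<open>i\<close> by
  \<open>n - Suc i\<close>.\<close>

locale typical_family =
  fixes G :: "'a set" and n :: nat and X :: "'a set set" and p :: real
  assumes finite_ground: "finite G" and card_ground: "card G = n" and n_large: "1000 \<le> n"
    and X_subset: "X \<subseteq> Pow G"
    and p_ge: "1 - 1 / 100000 \<le> p" and p_le: "p \<le> 1"
    and missing_up: "v \<subseteq> G \<Longrightarrow> 100000 * card {l \<in> G - v. insert l v \<notin> X} \<le> n"
    and missing_down: "v \<subseteq> G \<Longrightarrow> 100000 * card {l \<in> v. v - {l} \<notin> X} \<le> n"
    and up_degree_average: "n \<le> 3 * i \<Longrightarrow> 3 * i + 3 \<le> 2 * n \<Longrightarrow> z \<in> nsets G i \<Longrightarrow>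
      \<bar>\<Sum>x | x \<in> X \<inter> nsets G i \<and> card (x - z) = 2. real (up_degree G X x) - p * real (n - i)\<bar>
        \<le> real ((i choose 2) * ((n - i) choose 2)) / 1000000"
    and down_degree_average: "3 * j \<le> 2 * n \<Longrightarrow> n + 3 \<le> 3 * j \<Longrightarrow> z \<in> nsets G j \<Longrightarrow>
      \<bar>\<Sum>y | y \<in> X \<inter> nsets G j \<and> card (y - z) = 2. real (down_degree X y) - p * real j\<bar>
        \<le> real ((j choose 2) * ((n - j) choose 2)) / 1000000"
begin

section \<open>Symmetry of typical families under complementation\<close>

lemma up_degree_compl: "v \<subseteq> G \<Longrightarrow> up_degree G ((-) G ` X) (G - v) = down_degree X v"
proof -
  assume v: "v \<subseteq> G"
  have "insert l (G - v) \<in> (-) G ` X \<longleftrightarrow> v - {l} \<in> X" if "l \<in> v" for l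
  proof -
    have "G - insert l (G - v) = v - {l}" using v by auto
    thus ?thesis using compl_mem_image_iff[OF X_subset, of "insert l (G - v)"] that v by auto
  qed
  thus ?thesis unfolding up_degree_def down_degree_def using v
    by (intro arg_cong[where f = card]) auto
qed

lemma down_degree_compl: "v \<subseteq> G \<Longrightarrow> down_degree ((-) G ` X) (G - v) = up_degree G X v"
proof -
  assume v: "v \<subseteq> G"
  have "(G - v) - {l} \<in> (-) G ` X \<longleftrightarrow> insert l v \<in> X" if "l \<in> G - v" for l
  proof -
    have "G - ((G - v) - {l}) = insert l v" using v that by auto
    thus ?thesis using compl_mem_image_iff[OF X_subset, of "(G - v) - {l}"] that v by auto
  qed
  thus ?thesis unfolding up_degree_def down_degree_def using v
    by (intro arg_cong[where f = card]) auto
qed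

lemma sum_compl:
  assumes z: "z \<in> nsets G (n - i)" and i: "i \<le> n"
  shows "(\<Sum>x | x \<in> (-) G ` X \<inter> nsets G (n - i) \<and> card (x - z) = t. h x) =
         (\<Sum>x | x \<in> X \<inter> nsets G i \<and> card (x - (G - z)) = t. h (G - x))"
proof (rule sum.reindex_bij_witness[where i = "\<lambda>x. G - x" and j = "\<lambda>x. G - x"], goal_cases)
  case (1 a)
  thus ?case using X_subset by (auto simp: double_diff)
next
  have zG: "z \<subseteq> G" using z by (auto simp: nsets_def)
  have Gz: "G - z \<in> nsets G i"
    using compl_nsets[OF finite_ground zG, of "n - i"] z i card_ground by simp
  case (2 a)
  then obtain x where x: "x \<in> X" "a = G - x" by auto
  have xG: "x \<subseteq> G" using x X_subset by auto
  have xi: "x \<in> nsets G i"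
    using compl_nsets[OF finite_ground xG, of i] 2 x i card_ground by simp
  have "card (x - (G - z)) = t"
  proof -
    have "G - z - x = a - z" using x by auto
    hence "card (G - z - x) = t" using 2 by simp
    thus ?thesis using card_nsets_Int_Un(3)[OF finite_ground Gz xi] by simp
  qed
  thus ?case using x xi xG by (simp add: double_diff)
next
  case (3 b)
  thus ?case using X_subset by (auto simp: double_diff)
next
  have zG: "z \<subseteq> G" using z by (auto simp: nsets_def)
  have Gz: "G - z \<in> nsets G i"
    using compl_nsets[OF finite_ground zG, of "n - i"] z i card_ground by simp
  case (4 b)
  hence b: "b \<subseteq> G" "b \<in> nsets G i" by (auto simp: nsets_def)
  have "G - b \<in> nsets G (n - i)" using compl_nsets[OF finite_ground b(1), of i] b i card_ground by simp
  moreover have "card (G - b - z) = t"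
  proof -
    have "G - b - z = G - z - b" by auto
    thus ?thesis using card_nsets_Int_Un(3)[OF finite_ground b(2) Gz] 4 by simp
  qed
  ultimately show ?case using 4 by simp
next
  case (5 a)
  thus ?case using X_subset by (auto simp: double_diff)
qed

text \<open>Complementation exchanges \<open>missing_up\<close> with \<open>missing_down\<close> and
  \<open>up_degree_average\<close> with \<open>down_degree_average\<close>, including their ranges
  of levels. Every result on upper neighbours thus has a dual on lower neighbours.\<close>

lemma typical_family_compl: "typical_family G n ((-) G ` X) p"
proof
  show "finite G" "card G = n" "1000 \<le> n" "(-) G ` X \<subseteq> Pow G" "1 - 1 / 100000 \<le> p" "p \<le> 1"
    using finite_ground card_ground n_large p_ge p_le by auto
next
  fix v assume v: "v \<subseteq> G"
  have "insert l v \<in> (-) G ` X \<longleftrightarrow> (G - v) - {l} \<in> X" if "l \<in> G - v" for l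
  proof -
    have "G - insert l v = (G - v) - {l}" by auto
    thus ?thesis using compl_mem_image_iff[OF X_subset, of "insert l v"] that v by simp
  qed
  hence "{l \<in> G - v. insert l v \<notin> (-) G ` X} = {l \<in> G - v. (G - v) - {l} \<notin> X}" by auto
  thus "100000 * card {l \<in> G - v. insert l v \<notin> (-) G ` X} \<le> n"
    using missing_down[of "G - v"] by simp
next
  fix v assume v: "v \<subseteq> G"
  have "v - {l} \<in> (-) G ` X \<longleftrightarrow> insert l (G - v) \<in> X" if "l \<in> v" for l
  proof -
    have "G - (v - {l}) = insert l (G - v)" using v that by auto
    thus ?thesis using compl_mem_image_iff[OF X_subset, of "v - {l}"] v by auto
  qed
  hence "{l \<in> v. v - {l} \<notin> (-) G ` X} = {l \<in> G - (G - v). insert l (G - v) \<notin> X}" using v by auto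
  thus "100000 * card {l \<in> v. v - {l} \<notin> (-) G ` X} \<le> n"
    using missing_up[of "G - v"] by simp
next
  fix i z assume i: "n \<le> 3 * i" "3 * i + 3 \<le> 2 * n" and z: "z \<in> nsets G i"
  have Gz: "G - z \<in> nsets G (n - i)" using compl_nsets[OF finite_ground, of z i] z i card_ground by (auto simp: nsets_def)
  have "(\<Sum>x | x \<in> (-) G ` X \<inter> nsets G i \<and> card (x - z) = 2. real (up_degree G ((-) G ` X) x) - p * real (n - i)) =
        (\<Sum>x | x \<in> X \<inter> nsets G (n - i) \<and> card (x - (G - z)) = 2. real (up_degree G ((-) G ` X) (G - x)) - p * real (n - i))"
    using sum_compl[of z "n - i"] z i by simp
  also have "\<dots> = (\<Sum>x | x \<in> X \<inter> nsets G (n - i) \<and> card (x - (G - z)) = 2. real (down_degree X x) - p * real (n - i))"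
    by (rule sum.cong) (auto simp: up_degree_compl nsets_def)
  finally show "\<bar>\<Sum>x | x \<in> (-) G ` X \<inter> nsets G i \<and> card (x - z) = 2. real (up_degree G ((-) G ` X) x) - p * real (n - i)\<bar>
      \<le> real ((i choose 2) * ((n - i) choose 2)) / 1000000"
    using down_degree_average[OF _ _ Gz] i by (simp add: mult.commute)
next
  fix i z assume i: "3 * i \<le> 2 * n" "n + 3 \<le> 3 * i" and z: "z \<in> nsets G i"
  have Gz: "G - z \<in> nsets G (n - i)" using compl_nsets[OF finite_ground, of z i] z i card_ground by (auto simp: nsets_def)
  have "(\<Sum>x | x \<in> (-) G ` X \<inter> nsets G i \<and> card (x - z) = 2. real (down_degree ((-) G ` X) x) - p * real i) =
        (\<Sum>x | x \<in> X \<inter> nsets G (n - i) \<and> card (x - (G - z)) = 2. real (down_degree ((-) G ` X) (G - x)) - p * real i)"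
    using sum_compl[of z "n - i"] z i by simp
  also have "\<dots> = (\<Sum>x | x \<in> X \<inter> nsets G (n - i) \<and> card (x - (G - z)) = 2. real (up_degree G X x) - p * real i)"
    by (rule sum.cong) (auto simp: down_degree_compl nsets_def)
  finally show "\<bar>\<Sum>x | x \<in> (-) G ` X \<inter> nsets G i \<and> card (x - z) = 2. real (down_degree ((-) G ` X) x) - p * real i\<bar>
      \<le> real ((i choose 2) * ((n - i) choose 2)) / 1000000"
    using up_degree_average[OF _ _ Gz] i by (simp add: mult.commute)
qed

section \<open>Degrees, common neighbours and isoperimetry in spite of missing sets\<close>

lemma finite_level [simp]: "finite (nsets G i)"
  using finite_ground by (rule finite_imp_finite_nsets)

lemma up_degree_ge: "v \<subseteq> G \<Longrightarrow> 100000 * (n - card v) \<le> 100000 * up_degree G X v + n"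
proof -
  assume v: "v \<subseteq> G"
  have "card ({l \<in> G - v. insert l v \<in> X} \<union> {l \<in> G - v. insert l v \<notin> X}) =
      up_degree G X v + card {l \<in> G - v. insert l v \<notin> X}"
    unfolding up_degree_def by (rule card_Un_disjoint) (use finite_ground in auto)
  also have "{l \<in> G - v. insert l v \<in> X} \<union> {l \<in> G - v. insert l v \<notin> X} = G - v" by auto
  finally have "card (G - v) = up_degree G X v + card {l \<in> G - v. insert l v \<notin> X}" .
  thus ?thesis using missing_up[OF v] v finite_ground card_ground
    by (simp add: card_Diff_subset finite_subset)
qed

lemma up_degree_le: "v \<subseteq> G \<Longrightarrow> up_degree G X v \<le> n - card v"
  unfolding up_degree_def using finite_ground card_ground
    card_mono[of "G - v" "{l \<in> G - v. insert l v \<in> X}"] card_Diff_subset[of v G]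
  by (auto simp: finite_subset)

text \<open>An element of \<open>y \<inter> y'\<close> is lost only if removing it from
  \<open>y\<close>, \<open>y'\<close> or \<open>y \<union> y'\<close> gives a missing set. This
  happens for at most \<open>3 * n / 100000\<close> of the \<open>i \<ge> n / 3\<close>
  elements.\<close>

lemma common_covered:
  assumes i: "n \<le> 3 * i"
    and y: "y \<in> X \<inter> nsets G (Suc i)" "y' \<in> X \<inter> nsets G (Suc i)" "card (y - y') = 1"
  shows "n \<le> 4 * card {l \<in> y \<inter> y'. y - {l} \<in> X \<inter> nsets G i \<and> y' - {l} \<in> X \<inter> nsets G i \<and>
           (y \<union> y') - {l} \<in> X \<inter> nsets G (Suc i)}" (is "_ \<le> 4 * card ?T")
proof -
  have f: "finite y" "finite y'" "card y = Suc i" "card y' = Suc i" "y \<subseteq> G" "y' \<subseteq> G"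
    using y by (auto simp: nsets_def)
  have "y \<union> y' = y' \<union> (y - y')" by auto
  hence cU: "card (y \<union> y') = Suc (Suc i)" using f y(3)
    by (subst \<open>y \<union> y' = _\<close>, subst card_Un_disjoint) auto
  let ?A = "{l \<in> y. y - {l} \<notin> X}" and ?B = "{l \<in> y'. y' - {l} \<notin> X}" and ?C = "{l \<in> y \<union> y'. (y \<union> y') - {l} \<notin> X}"
  have "card (y \<inter> y') \<le> card ?T + card ?A + card ?B + card ?C"
  proof (rule card_le_Un4)
    show "y \<inter> y' \<subseteq> ?T \<union> ?A \<union> ?B \<union> ?C"
    proof
      fix l assume l: "l \<in> y \<inter> y'"
      hence "y - {l} \<in> nsets G i" "y' - {l} \<in> nsets G i" "(y \<union> y') - {l} \<in> nsets G (Suc i)"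
        using f cU by (auto simp: nsets_def)
      thus "l \<in> ?T \<union> ?A \<union> ?B \<union> ?C" using l by auto
    qed
  qed (use f in auto)
  moreover have "card (y \<inter> y') = i"
    using card_nsets_Int_Un(1)[OF finite_ground, of y "Suc i" y' 1] y by auto
  moreover have "100000 * card ?A \<le> n" "100000 * card ?B \<le> n" "100000 * card ?C \<le> n"
    using missing_down[OF f(5)] missing_down[OF f(6)] missing_down[of "y \<union> y'"] f by blast+
  ultimately show ?thesis using i n_large by linarith
qed

lemma common_covers:
  assumes i: "n \<le> 3 * i" "3 * i + 3 \<le> 2 * n"
    and x: "x \<in> nsets G i" "x' \<in> nsets G i" "card (x - x') = 1"
  shows "n \<le> 4 * card {l \<in> G - (x \<union> x'). insert l x \<in> X \<inter> nsets G (Suc i) \<and>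
           insert l x' \<in> X \<inter> nsets G (Suc i) \<and> insert l (x \<inter> x') \<in> nsets G i}" (is "_ \<le> 4 * card ?T")
proof -
  have f: "finite x" "finite x'" "card x = i" "card x' = i" "x \<subseteq> G" "x' \<subseteq> G"
    using x by (auto simp: nsets_def)
  have cI: "card (x \<inter> x') = i - 1" "card (G - (x \<union> x')) = n - i - 1"
    using card_nsets_Int_Un(1,2)[OF finite_ground x] card_ground by auto
  let ?A = "{l \<in> G - x. insert l x \<notin> X}" and ?B = "{l \<in> G - x'. insert l x' \<notin> X}"
  \<comment> \<open>The path returns through the full level \<open>i\<close>, where
    \<open>insert l (x \<inter> x')\<close> always is, so the last exceptional set is empty.\<close>
  have "card (G - (x \<union> x')) \<le> card ?T + card ?A + card ?B + card ({}::'a set)"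
  proof (rule card_le_Un4)
    show "G - (x \<union> x') \<subseteq> ?T \<union> ?A \<union> ?B \<union> {}"
    proof
      fix l assume l: "l \<in> G - (x \<union> x')"
      hence "insert l x \<in> nsets G (Suc i)" "insert l x' \<in> nsets G (Suc i)" "insert l (x \<inter> x') \<in> nsets G i"
        using f cI i n_large by (auto simp: nsets_def)
      thus "l \<in> ?T \<union> ?A \<union> ?B \<union> {}" using l by auto
    qed
  qed (use finite_ground in auto)
  moreover have "100000 * card ?A \<le> n" "100000 * card ?B \<le> n"
    using missing_up[OF f(5)] missing_up[OF f(6)] by blast+
  ultimately show ?thesis using i n_large cI by simp
qed

text \<open>Membership in \<open>A\<close> and \<open>T\<close> is propagated to the missing sets of the lower level by a majority
  vote of their present upper neighbours. Two disagreeing upper neighbours of a missing set are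
  joined by many paths of length four, each of which contains a mismatch.\<close>

lemma extension_to_level:
  assumes i: "n \<le> 3 * i" "3 * i + 3 \<le> 2 * n"
    and A: "A \<subseteq> X \<inter> nsets G i" and T: "T \<subseteq> X \<inter> nsets G (Suc i)"
  defines "D \<equiv> card (mismatches (\<lambda>x. x \<in> A) (\<lambda>y. y \<in> T) (X \<inter> nsets G i) (X \<inter> nsets G (Suc i)))"
  obtains E where "E \<subseteq> nsets G i" "E \<inter> X = A"
    "card (separated 1 (\<lambda>x. x \<in> E) (nsets G i)) \<le> 1040 * n * D"
    "card E \<le> card A + 8 * card T"
proof -
  let ?L = "nsets G i" and ?U = "X \<inter> nsets G (Suc i)"
  \<comment> \<open>\<open>m\<close> is \<open>n / 4\<close> rounded up.\<close>
  define m where "m = (n + 3) div 4"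
  have m: "n \<le> 4 * m" "\<And>c. n \<le> 4 * c \<Longrightarrow> m \<le> c" by (auto simp: m_def)
  have n0: "0 < n" using n_large by simp
  define V where "V = separated 1 (\<lambda>y. y \<in> T) ?U"
  have fV: "finite V" by (simp add: V_def finite_separated)
  have "m * card V \<le> 4 * (card G)\<^sup>2 * D" unfolding V_def D_def
    by (rule card_separated_1_dual[OF finite_ground, where i = i]) (use common_covered[OF i(1)] in \<open>auto intro!: m(2)\<close>)
  hence "4 * (m * card V) \<le> n * (16 * n * D)" by (simp add: card_ground power2_eq_square mult_ac)
  moreover have "n * card V \<le> 4 * (m * card V)" using m(1) by (subst mult.assoc[symmetric], intro mult_right_mono) auto
  ultimately have "n * card V \<le> n * (16 * n * D)" by (rule order_trans[rotated])
  hence V: "card V \<le> 16 * n * D" using n0 by (subst (asm) nat_mult_le_cancel1) auto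

  define P where "P = (\<lambda>x. {y \<in> ?U. x \<subseteq> y})"
  define E where "E = A \<union> {x \<in> ?L - X. card (P x - T) \<le> card (P x \<inter> T)}"
  \<comment> \<open>\<open>w x\<close> counts the mismatches between \<open>x\<close> and its
    present upper neighbours; for a missing \<open>x\<close> this is the size of the
    minority.\<close>
  define w where "w = (\<lambda>x. card {y \<in> P x. (y \<in> T) \<noteq> (x \<in> E)})"
  have fP: "finite (P x)" for x by (simp add: P_def)
  have P4: "n \<le> 4 * card (P x)" if "x \<in> ?L" for x
  proof -
    have "card (P x) = up_degree G X x"
      using card_covers[OF finite_ground that, of ?U] that
      by (auto simp: P_def up_degree_def nsets_def intro!: arg_cong[where f = card])
    moreover have "x \<subseteq> G" "card x = i" using that by (auto simp: nsets_def)
    ultimately show ?thesis using up_degree_ge[of x] i n_large by simp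
  qed
  have cP: "card (P x) = card (P x \<inter> T) + card (P x - T)" for x
    using card_Int_Diff[OF fP] .
  have w: "n * w x \<le> 4 * (2 * card (P x \<inter> T) * card (P x - T))" if "x \<in> ?L - X" for x
  proof -
    let ?t = "card (P x \<inter> T)" and ?s = "card (P x - T)"
    have "w x \<le> min ?t ?s"
    proof (cases "x \<in> E")
      case True
      hence "?s \<le> ?t" using that A by (auto simp: E_def)
      moreover have "{y \<in> P x. (y \<in> T) \<noteq> (x \<in> E)} = P x - T" using True by auto
      ultimately show ?thesis by (simp add: w_def)
    next
      case False
      hence "?t \<le> ?s" using that by (auto simp: E_def)
      moreover have "{y \<in> P x. (y \<in> T) \<noteq> (x \<in> E)} = P x \<inter> T" using False by auto
      ultimately show ?thesis by (simp add: w_def)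
    qed
    \<comment> \<open>The larger of \<open>?t\<close> and \<open>?s\<close> is at least half of
      \<open>?t + ?s\<close>, which is at least \<open>n / 4\<close>; hence
      \<open>2 * ?t * ?s\<close> dominates \<open>n / 4\<close> times the minority.\<close>
    have "n * w x \<le> 4 * (?t + ?s) * min ?t ?s"
      using P4[of x] that cP[of x] \<open>w x \<le> _\<close> by (intro mult_mono) auto
    also have "\<dots> \<le> 4 * (2 * max ?t ?s) * min ?t ?s"
      by (intro mult_right_mono) auto
    also have "\<dots> = 4 * (2 * ?t * ?s)"
      by (simp add: max_def min_def)
    finally show ?thesis .
  qed
  \<comment> \<open>Two disagreeing upper neighbours \<open>y\<close> and \<open>y'\<close> of a
    missing \<open>x\<close> form a pair in \<open>V\<close>. Since \<open>x = y \<inter> y'\<close>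
    can be recovered from it, the sets \<open>Q x\<close> are disjoint.\<close>
  have "(\<Sum>x\<in>?L - X. 2 * card (P x \<inter> T) * card (P x - T)) \<le> card V"
  proof -
    define Q where "Q = (\<lambda>x. (P x \<inter> T) \<times> (P x - T) \<union> (P x - T) \<times> (P x \<inter> T))"
    have Q: "x = y \<inter> y' \<and> (y, y') \<in> V" if "x \<in> ?L - X" "(y, y') \<in> Q x" for x y y'
    proof -
      have y: "y \<in> ?U" "y' \<in> ?U" "x \<subseteq> y" "x \<subseteq> y'" "y \<noteq> y'" "(y \<in> T) \<noteq> (y' \<in> T)"
        using that by (auto simp: Q_def P_def)
      have f: "finite y" "finite y'" "card y = Suc i" "card y' = Suc i" "card x = i" "finite x"
        using y that by (auto simp: nsets_def)
      have "y \<inter> y' \<noteq> y" using y f by (metis card_subset_eq inf.absorb_iff1)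
      hence "card (y \<inter> y') < card y" using f by (intro psubset_card_mono) auto
      hence "x = y \<inter> y'" using f y by (intro card_seteq) auto
      moreover have "card (y - y') = 1"
        using card_Int_Diff[of y y'] f \<open>x = y \<inter> y'\<close> by simp
      ultimately show ?thesis using y by (auto simp: V_def separated_def)
    qed
    have "(\<Sum>x\<in>?L - X. 2 * card (P x \<inter> T) * card (P x - T)) = (\<Sum>x\<in>?L - X. card (Q x))"
    proof (rule sum.cong[OF refl])
      fix x
      have "card (Q x) = card ((P x \<inter> T) \<times> (P x - T)) + card ((P x - T) \<times> (P x \<inter> T))"
        unfolding Q_def by (rule card_Un_disjoint) (auto simp: fP)
      thus "2 * card (P x \<inter> T) * card (P x - T) = card (Q x)"
        by (simp add: card_cartesian_product)
    qed
    also have "\<dots> = card (\<Union>x\<in>?L - X. Q x)"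
    proof (rule card_UN_disjoint[symmetric])
      show "\<forall>x\<in>?L - X. \<forall>z\<in>?L - X. x \<noteq> z \<longrightarrow> Q x \<inter> Q z = {}"
      proof (intro ballI impI equals0I)
        fix x z q assume "x \<in> ?L - X" "z \<in> ?L - X" "x \<noteq> z" "q \<in> Q x \<inter> Q z"
        thus False using Q[of x "fst q" "snd q"] Q[of z "fst q" "snd q"] by auto
      qed
    qed (auto simp: Q_def fP)
    also have "\<dots> \<le> card V" using Q fV by (intro card_mono) auto
    finally show ?thesis .
  qed
  hence "4 * (\<Sum>x\<in>?L - X. 2 * card (P x \<inter> T) * card (P x - T)) \<le> 4 * (16 * n * D)"
    using V by linarith
  moreover have "n * (\<Sum>x\<in>?L - X. w x) \<le> 4 * (\<Sum>x\<in>?L - X. 2 * card (P x \<inter> T) * card (P x - T))"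
    unfolding sum_distrib_left using w by (intro sum_mono) auto
  ultimately have "n * (\<Sum>x\<in>?L - X. w x) \<le> 4 * (16 * n * D)" by (rule order_trans[rotated])
  also have "\<dots> = n * (64 * D)" by simp
  finally have "n * (\<Sum>x\<in>?L - X. w x) \<le> n * (64 * D)" .
  hence W: "(\<Sum>x\<in>?L - X. w x) \<le> 64 * D" using n0 by (subst (asm) nat_mult_le_cancel1) auto

  have EX: "E \<inter> X = A" using A by (auto simp: E_def)
  have EL: "E \<subseteq> ?L" using A by (auto simp: E_def)
  \<comment> \<open>The factor is 1 for the edges at present sets plus 64 for those at missing ones.
    The path count below multiplies it by \<open>16 * n\<close>, which yields 1040.\<close>
  have D1: "card (mismatches (\<lambda>x. x \<in> E) (\<lambda>y. y \<in> T) ?L ?U) \<le> 65 * D"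
  proof -
    have "mismatches (\<lambda>x. x \<in> E) (\<lambda>y. y \<in> T) ?L ?U \<subseteq>
       mismatches (\<lambda>x. x \<in> A) (\<lambda>y. y \<in> T) (X \<inter> ?L) ?U \<union>
       (SIGMA x:?L - X. {y \<in> P x. (y \<in> T) \<noteq> (x \<in> E)})"
      using EX by (auto simp: mismatches_def P_def)
    hence "card (mismatches (\<lambda>x. x \<in> E) (\<lambda>y. y \<in> T) ?L ?U) \<le> 
      card (mismatches (\<lambda>x. x \<in> A) (\<lambda>y. y \<in> T) (X \<inter> ?L) ?U \<union>
       (SIGMA x:?L - X. {y \<in> P x. (y \<in> T) \<noteq> (x \<in> E)}))"
      by (intro card_mono finite_UnI finite_SigmaI finite_mismatches) (auto simp: fP)
    also have "\<dots> \<le> D + card (SIGMA x:?L - X. {y \<in> P x. (y \<in> T) \<noteq> (x \<in> E)})"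
      unfolding D_def by (rule card_Un_le)
    also have "card (SIGMA x:?L - X. {y \<in> P x. (y \<in> T) \<noteq> (x \<in> E)}) = (\<Sum>x\<in>?L - X. w x)"
      unfolding w_def by (rule card_SigmaI) (auto simp: fP)
    finally show ?thesis using W by simp
  qed
  have "m * card (separated 1 (\<lambda>x. x \<in> E) ?L) \<le> 4 * (card G)\<^sup>2 * card (mismatches (\<lambda>x. x \<in> E) (\<lambda>y. y \<in> T) ?L ?U)"
    by (rule card_separated_1[OF finite_ground, where i = i]) (use common_covers[OF i] in \<open>auto intro!: m(2)\<close>)
  also have "\<dots> \<le> 4 * (card G)\<^sup>2 * (65 * D)" by (intro mult_left_mono D1) auto
  finally have "4 * (m * card (separated 1 (\<lambda>x. x \<in> E) ?L)) \<le> n * (1040 * n * D)"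
    by (simp add: card_ground power2_eq_square mult_ac)
  moreover have "n * card (separated 1 (\<lambda>x. x \<in> E) ?L) \<le> 4 * (m * card (separated 1 (\<lambda>x. x \<in> E) ?L))"
    using m(1) by (subst mult.assoc[symmetric], intro mult_right_mono) auto
  ultimately have "n * card (separated 1 (\<lambda>x. x \<in> E) ?L) \<le> n * (1040 * n * D)" by (rule order_trans[rotated])
  hence B: "card (separated 1 (\<lambda>x. x \<in> E) ?L) \<le> 1040 * n * D" using n0 by (subst (asm) nat_mult_le_cancel1) auto

  \<comment> \<open>Every missing set put into \<open>E\<close> has at least \<open>n / 8\<close>
    upper neighbours in \<open>T\<close>, while a member of \<open>T\<close> has at most
    \<open>n\<close> lower neighbours.\<close>
  have "card E \<le> card A + 8 * card T"
  proof -
    let ?R = "{x \<in> ?L - X. card (P x - T) \<le> card (P x \<inter> T)}"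
    have "n * card ?R = (\<Sum>x\<in>?R. n)" by simp
    also have "\<dots> \<le> (\<Sum>x\<in>?R. 8 * card (P x \<inter> T))"
    proof (rule sum_mono)
      fix x assume "x \<in> ?R"
      thus "n \<le> 8 * card (P x \<inter> T)" using P4[of x] cP[of x] by auto
    qed
    also have "\<dots> = 8 * card (SIGMA x:?R. P x \<inter> T)"
      unfolding sum_distrib_left[symmetric] by (subst card_SigmaI) (auto simp: fP)
    also have "card (SIGMA x:?R. P x \<inter> T) \<le> card ((\<lambda>(y, x). (x, y)) ` (SIGMA y:T. {x \<in> ?L. x \<subseteq> y}))"
      by (intro card_mono finite_imageI finite_SigmaI finite_subset[OF T]) (force simp: P_def)+
    also have "\<dots> \<le> card (SIGMA y:T. {x \<in> ?L. x \<subseteq> y})"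
      by (intro card_image_le finite_SigmaI finite_subset[OF T]) auto
    also have "\<dots> = (\<Sum>y\<in>T. card {x \<in> ?L. x \<subseteq> y})"
      by (intro card_SigmaI finite_subset[OF T]) auto
    also have "\<dots> \<le> (\<Sum>y\<in>T. n)"
    proof (rule sum_mono)
      fix y assume "y \<in> T"
      hence y: "y \<in> nsets G (Suc i)" using T by auto
      have "card {x \<in> ?L. x \<subseteq> y} \<le> card y"
        unfolding card_covered[OF finite_ground y order_refl] using y by (intro card_mono) (auto simp: nsets_def)
      also have "\<dots> \<le> n" using y card_mono[OF finite_ground, of y] card_ground by (auto simp: nsets_def)
      finally show "card {x \<in> ?L. x \<subseteq> y} \<le> n" .
    qed
    finally have "n * card ?R \<le> n * (8 * card T)" by simp
    hence "card ?R \<le> 8 * card T" using n0 by (subst (asm) nat_mult_le_cancel1) auto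
    thus ?thesis unfolding E_def using card_Un_le[of A ?R] by linarith
  qed
  with EL EX B show ?thesis by (rule that)
qed

text \<open>Isoperimetry of the full level is applied to the extension \<open>E\<close> of
  \<open>A\<close>. Because \<open>E \<inter> X = A\<close>, the two parts of the present level lie
  in the two parts of the full one. The constant is 3 times 1040, the 3 coming from
  \<open>n \<le> 3 * (n - i)\<close>.\<close>

lemma min_card_le_mismatches:
  assumes i: "n \<le> 3 * i" "3 * i + 3 \<le> 2 * n"
    and A: "A \<subseteq> X \<inter> nsets G i" and T: "T \<subseteq> X \<inter> nsets G (Suc i)"
  shows "min (card A) (card (X \<inter> nsets G i - A)) \<le>
    3120 * card (mismatches (\<lambda>x. x \<in> A) (\<lambda>y. y \<in> T) (X \<inter> nsets G i) (X \<inter> nsets G (Suc i)))"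
    (is "?m \<le> 3120 * ?D")
proof -
  obtain E where E: "E \<subseteq> nsets G i" "E \<inter> X = A"
    and B: "card (separated 1 (\<lambda>x. x \<in> E) (nsets G i)) \<le> 1040 * n * ?D"
    using extension_to_level[OF i A T] by blast
  let ?L = "nsets G i"
  let ?e = "card {x \<in> ?L. x \<in> E}" and ?c = "card {x \<in> ?L. x \<notin> E}"
  have "card A \<le> ?e" "card (X \<inter> ?L - A) \<le> ?c" using E A by (auto intro!: card_mono)
  hence m: "?m \<le> ?e" "?m \<le> ?c" by auto
  have L: "card ?L = ?e + ?c"
  proof -
    have "?L = {x \<in> ?L. x \<in> E} \<union> {x \<in> ?L. x \<notin> E}" by auto
    hence "card ?L = card ({x \<in> ?L. x \<in> E} \<union> {x \<in> ?L. x \<notin> E})" by (rule arg_cong)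
    also have "\<dots> = ?e + ?c" by (rule card_Un_disjoint) auto
    finally show ?thesis .
  qed
  have iso: "2 * ?e * ?c * (n - i) \<le> (1040 * n * ?D) * (?e + ?c)"
  proof -
    have "2 * ?e * ?c * (n - i) \<le> card (separated 1 (\<lambda>x. x \<in> E) ?L) * card ?L"
      using Johnson_isoperimetry[OF finite_ground refl, of i "\<lambda>x. x \<in> E"] i n_large card_ground by simp
    also have "\<dots> \<le> (1040 * n * ?D) * (?e + ?c)" unfolding L[symmetric] using B by (rule mult_right_mono) simp
    finally show ?thesis .
  qed
  show ?thesis
  proof (cases "?e + ?c = 0")
    case False
    have "?m * ?e \<le> ?c * ?e" "?m * ?c \<le> ?e * ?c" using m by (auto intro: mult_right_mono)
    hence "?m * ?e + ?m * ?c \<le> ?c * ?e + ?e * ?c" by (rule add_mono)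
    also have "\<dots> = 2 * ?e * ?c" by simp
    finally have "?m * (?e + ?c) \<le> 2 * ?e * ?c" unfolding distrib_left .
    hence "?m * (?e + ?c) * (n - i) \<le> (1040 * n * ?D) * (?e + ?c)"
      using iso by (meson mult_right_mono order_trans zero_le)
    hence "(?e + ?c) * (?m * (n - i)) \<le> (?e + ?c) * (1040 * n * ?D)" by (simp only: mult_ac)
    moreover have "0 < ?e + ?c" using False by (simp only: neq0_conv)
    ultimately have 1: "?m * (n - i) \<le> 1040 * n * ?D" by (simp only: nat_mult_le_cancel1)
    have "n * ?m \<le> (3 * (n - i)) * ?m" using i by (intro mult_right_mono) auto
    also have "\<dots> \<le> n * (3120 * ?D)" using 1 by (simp add: mult_ac)
    finally show ?thesis using n_large by (subst (asm) nat_mult_le_cancel1) auto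
  qed (use m in linarith)
qed

section \<open>Degree sums and the key inequality\<close>

lemma up_degree_deviation:
  assumes v: "v \<in> nsets G i"
  shows "\<bar>real (up_degree G X v) - p * real (n - i)\<bar> \<le> n / 100000"
proof -
  have vG: "v \<subseteq> G" "card v = i" using v by (auto simp: nsets_def)
  have "100000 * real (n - i) \<le> 100000 * real (up_degree G X v) + real n"
    using up_degree_ge[OF vG(1)] vG(2) by linarith
  moreover have "real (up_degree G X v) \<le> real (n - i)"
    using up_degree_le[OF vG(1)] vG(2) by linarith
  moreover have "p * real (n - i) \<le> 1 * real (n - i)" using p_le by (rule mult_right_mono) simp
  moreover have "real (n - i) - real (n - i) / 100000 \<le> p * real (n - i)"
    using mult_right_mono[OF p_ge, of "real (n - i)"] by (simp add: algebra_simps)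
  moreover have "real (n - i) \<le> real n" by simp
  ultimately show ?thesis unfolding abs_le_iff by linarith
qed

text \<open>Give each pair \<open>(x, z)\<close> at distance 2 with \<open>x\<close> present the
  weight \<open>h x\<close>, the deviation of the degree. The pairs with \<open>x\<close> in
  \<open>E\<close> have total weight \<open>M\<close> times the sum over \<open>A\<close>. In the
  total over the pairs with \<open>z\<close> in \<open>E\<close>, each \<open>z\<close> contributes
  at most \<open>M / 1000000\<close> in absolute value, by \<open>up_degree_average\<close>. The two
  totals differ only on pairs separated by \<open>E\<close>, which are few by
  \<open>card_separated_le\<close>.\<close>

lemma sum_up_degree_deviation:
  assumes i: "n \<le> 3 * i" "3 * i + 3 \<le> 2 * n"
    and A: "A \<subseteq> X \<inter> nsets G i" and T: "T \<subseteq> X \<inter> nsets G (Suc i)"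
  defines "D \<equiv> card (mismatches (\<lambda>x. x \<in> A) (\<lambda>y. y \<in> T) (X \<inter> nsets G i) (X \<inter> nsets G (Suc i)))"
  shows "\<bar>\<Sum>x\<in>A. real (up_degree G X x) - p * real (n - i)\<bar> \<le> D / 10 + (card A + 8 * card T) / 1000000"
proof -
  obtain E where E: "E \<subseteq> nsets G i" "E \<inter> X = A"
    and B: "card (separated 1 (\<lambda>x. x \<in> E) (nsets G i)) \<le> 1040 * n * D"
    and cE: "card E \<le> card A + 8 * card T"
    using extension_to_level[OF i A T] unfolding D_def by blast
  let ?L = "nsets G i"
  define h where "h = (\<lambda>x. real (up_degree G X x) - p * real (n - i))"
  define M where "M = (i choose 2) * ((n - i) choose 2)"
  have M0: "0 < M" unfolding M_def using i n_large by simp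
  define W where "W = card (separated 2 (\<lambda>x. x \<in> E) ?L)"
  have W: "real n * real W \<le> 10000 * real M * real D"
  proof -
    have "W * (i * (n - i)) \<le> 2 * M * card (separated 1 (\<lambda>x. x \<in> E) ?L)"
      using card_separated_le[OF finite_ground refl, of 2 "\<lambda>x. x \<in> E" i] by (simp add: W_def M_def card_ground)
    also have "\<dots> \<le> 2 * M * (1040 * n * D)" using B by (rule mult_left_mono) simp
    finally have "real (W * (i * (n - i))) \<le> real (2 * M * (1040 * n * D))" by (rule of_nat_mono)
    hence 1: "real W * (real i * real (n - i)) \<le> 2080 * real M * real n * real D" by simp
    \<comment> \<open>As \<open>i\<close> and \<open>n - i\<close> are at least
      \<open>n / 3\<close>, their product is at least \<open>2 / 9 * n\<^sup>2\<close>. Hence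
      \<open>n * W\<close> is at most \<open>2080 * 9 / 2 = 9360\<close> times
      \<open>M * D\<close>.\<close>
    have "0 \<le> (real i - real n / 3) * (real (n - i) - real n / 3)"
      using i by (intro mult_nonneg_nonneg) auto
    also have "(real i - real n / 3) * (real (n - i) - real n / 3) = real i * real (n - i) - 2 / 9 * (real n * real n)"
    proof -
      have "real (n - i) = real n - real i" using i by simp
      thus ?thesis by (simp add: field_simps)
    qed
    finally have "2 / 9 * (real n * real n) \<le> real i * real (n - i)" by simp
    hence "real W * (2 / 9 * (real n * real n)) \<le> real W * (real i * real (n - i))"
      by (rule mult_left_mono) simp
    with 1 have "real n * (real W * (2 / 9 * real n)) \<le> real n * (2080 * real M * real D)"
      by (simp add: mult_ac)
    hence "real W * (2 / 9 * real n) \<le> 2080 * real M * real D"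
      using n_large by (subst (asm) mult_le_cancel_left_pos) auto
    hence "real n * real W \<le> 9360 * (real M * real D)" by (simp add: mult_ac)
    also have "\<dots> \<le> 10000 * (real M * real D)" by (intro mult_right_mono) auto
    finally show ?thesis by (simp only: mult.assoc)
  qed
  define P where "P = {(x, z). x \<in> X \<inter> ?L \<and> z \<in> ?L \<and> card (x - z) = 2}"
  have fP: "finite P" by (rule finite_subset[of _ "?L \<times> ?L"]) (auto simp: P_def)
  have 1: "M * (\<Sum>x\<in>A. h x) = (\<Sum>(x, z)\<in>P. h x * of_bool (x \<in> E))"
  proof -
    have "(\<Sum>(x, z)\<in>P. h x * of_bool (x \<in> E)) = (\<Sum>(x, z)\<in>(SIGMA x:A. {z \<in> ?L. card (x - z) = 2}). h x)"
      using fP E A by (intro sum.mono_neutral_cong_right) (auto simp: P_def)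
    also have "\<dots> = (\<Sum>x\<in>A. \<Sum>z | z \<in> ?L \<and> card (x - z) = 2. h x)"
      using A by (subst sum.Sigma) (auto intro: finite_subset)
    also have "\<dots> = (\<Sum>x\<in>A. real M * h x)"
    proof (rule sum.cong[OF refl])
      fix x assume "x \<in> A"
      hence x: "x \<in> ?L" using A by auto
      have "{z \<in> ?L. card (x - z) = 2} = {z \<in> ?L. card (z - x) = 2}"
        using card_nsets_Int_Un(3)[OF finite_ground x] card_nsets_Int_Un(3)[OF finite_ground _ x] by blast
      thus "(\<Sum>z | z \<in> ?L \<and> card (x - z) = 2. h x) = real M * h x"
        using card_nsets_at_distance[OF finite_ground x, of 2] by (simp add: M_def card_ground)
    qed
    finally show ?thesis by (simp add: sum_distrib_left)
  qed
  have 2: "\<bar>\<Sum>(x, z)\<in>P. h x * of_bool (z \<in> E)\<bar> \<le> card E * (M / 1000000)"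
  proof -
    have "(\<Sum>(x, z)\<in>P. h x * of_bool (z \<in> E)) = (\<Sum>(z, x)\<in>(SIGMA z:E. {x \<in> X \<inter> ?L. card (x - z) = 2}). h x)"
    proof -
      have "(\<Sum>(x, z)\<in>P. h x * of_bool (z \<in> E)) = (\<Sum>(x, z)\<in>{(x, z) \<in> P. z \<in> E}. h x)"
        using fP by (intro sum.mono_neutral_cong_right) auto
      also have "\<dots> = (\<Sum>(z, x)\<in>(SIGMA z:E. {x \<in> X \<inter> ?L. card (x - z) = 2}). h x)"
        using E by (intro sum.reindex_bij_witness[where i = "\<lambda>(z, x). (x, z)" and j = "\<lambda>(x, z). (z, x)"])
          (auto simp: P_def)
      finally show ?thesis .
    qed
    also have "\<dots> = (\<Sum>z\<in>E. \<Sum>x | x \<in> X \<inter> ?L \<and> card (x - z) = 2. h x)"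
      using E by (subst sum.Sigma) (auto intro: finite_subset)
    finally have "\<bar>\<Sum>(x, z)\<in>P. h x * of_bool (z \<in> E)\<bar> = \<bar>\<Sum>z\<in>E. \<Sum>x | x \<in> X \<inter> ?L \<and> card (x - z) = 2. h x\<bar>"
      by (rule arg_cong)
    also have "\<dots> \<le> (\<Sum>z\<in>E. \<bar>\<Sum>x | x \<in> X \<inter> ?L \<and> card (x - z) = 2. h x\<bar>)"
      by (rule sum_abs)
    also have "\<dots> \<le> (\<Sum>z\<in>E. real M / 1000000)"
      using up_degree_average[OF i] E by (intro sum_mono) (auto simp: h_def M_def)
    finally show ?thesis by simp
  qed
  have 3: "\<bar>(\<Sum>(x, z)\<in>P. h x * of_bool (x \<in> E)) - (\<Sum>(x, z)\<in>P. h x * of_bool (z \<in> E))\<bar> \<le> M * (D / 10)"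
  proof -
    have "\<bar>(\<Sum>(x, z)\<in>P. h x * of_bool (x \<in> E)) - (\<Sum>(x, z)\<in>P. h x * of_bool (z \<in> E))\<bar> =
      \<bar>\<Sum>(x, z)\<in>P. h x * of_bool (x \<in> E) - h x * of_bool (z \<in> E)\<bar>"
      unfolding sum_subtractf[symmetric] by (simp add: case_prod_unfold)
    also have "\<dots> \<le> (\<Sum>(x, z)\<in>P. \<bar>h x * of_bool (x \<in> E) - h x * of_bool (z \<in> E)\<bar>)"
      by (rule order_trans[OF sum_abs]) (simp add: case_prod_unfold)
    also have "\<dots> = (\<Sum>(x, z)\<in>P \<inter> separated 2 (\<lambda>x. x \<in> E) ?L. \<bar>h x\<bar>)"
      using fP by (intro sum.mono_neutral_cong_right) (auto simp: separated_def P_def)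
    \<comment> \<open>A single deviation is at most \<open>n / 100000\<close>; together with
      \<open>n * W \<le> 10000 * M * D\<close> this produces \<open>M * D / 10\<close>.\<close>
    also have "\<dots> \<le> (\<Sum>(x, z)\<in>P \<inter> separated 2 (\<lambda>x. x \<in> E) ?L. real n / 100000)"
      using up_degree_deviation by (intro sum_mono) (auto simp: P_def h_def)
    also have "\<dots> \<le> W * (real n / 100000)"
      unfolding W_def by (auto intro!: divide_right_mono mult_right_mono card_mono finite_separated)
    also have "\<dots> \<le> M * (D / 10)" using W by (simp add: mult_ac)
    finally show ?thesis .
  qed
  have "M * \<bar>\<Sum>x\<in>A. h x\<bar> = \<bar>M * (\<Sum>x\<in>A. h x)\<bar>" by (simp add: abs_mult)
  also have "\<dots> \<le> M * (D / 10) + card E * (M / 1000000)" using 1 2 3 by linarith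
  also have "\<dots> = M * (D / 10 + card E / 1000000)" by (simp add: algebra_simps)
  finally have "\<bar>\<Sum>x\<in>A. h x\<bar> \<le> D / 10 + card E / 1000000"
    using M0 by (subst (asm) mult_le_cancel_left_pos) auto
  also have "\<dots> \<le> D / 10 + (card A + 8 * card T) / 1000000" using cE by simp
  finally show ?thesis by (simp add: h_def)
qed

lemma compl_level:
  assumes i: "i \<le> n"
  shows "(-) G ` (X \<inter> nsets G i) = (-) G ` X \<inter> nsets G (n - i)"
proof (rule set_eqI)
  fix y
  show "y \<in> (-) G ` (X \<inter> nsets G i) \<longleftrightarrow> y \<in> (-) G ` X \<inter> nsets G (n - i)"
  proof (cases "y \<subseteq> G")
    case True
    have "X \<inter> nsets G i \<subseteq> Pow G" using X_subset by auto
    thus ?thesis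
      using compl_mem_image_iff[OF X_subset True] compl_mem_image_iff[OF _ True, of "X \<inter> nsets G i"]
        compl_nsets[OF finite_ground True, of "n - i"] i card_ground by simp
  qed (auto simp: nsets_def)
qed

text \<open>In the complemented family the complements of \<open>T\<close> lie on level
  \<open>n - Suc i\<close> and take the place of \<open>A\<close>, with equally many mismatches, so
  \<open>sum_up_degree_deviation\<close> applies there.\<close>

lemma sum_down_degree_deviation:
  assumes i: "n \<le> 3 * i" "3 * i + 3 \<le> 2 * n"
    and A: "A \<subseteq> X \<inter> nsets G i" and T: "T \<subseteq> X \<inter> nsets G (Suc i)"
  defines "D \<equiv> card (mismatches (\<lambda>x. x \<in> A) (\<lambda>y. y \<in> T) (X \<inter> nsets G i) (X \<inter> nsets G (Suc i)))"
  shows "\<bar>\<Sum>y\<in>T. real (down_degree X y) - p * real (Suc i)\<bar> \<le> D / 10 + (card T + 8 * card A) / 1000000"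
proof -
  interpret C: typical_family G n "(-) G ` X" p by (rule typical_family_compl)
  let ?c = "(-) G" and ?j = "n - Suc i"
  have AG: "A \<subseteq> Pow G" "T \<subseteq> Pow G" using A T X_subset by auto
  have j: "n \<le> 3 * ?j" "3 * ?j + 3 \<le> 2 * n" "Suc ?j = n - i" "n - ?j = Suc i" using i by auto
  have l1: "?c ` (X \<inter> nsets G (Suc i)) = ?c ` X \<inter> nsets G ?j"
    using compl_level[of "Suc i"] i by simp
  have l2: "?c ` (X \<inter> nsets G i) = ?c ` X \<inter> nsets G (Suc ?j)"
    using compl_level[of i] i j(3) by simp
  have "card (mismatches (\<lambda>y. y \<in> ?c ` T) (\<lambda>x. x \<in> ?c ` A) (?c ` X \<inter> nsets G ?j) (?c ` X \<inter> nsets G (Suc ?j))) = D"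
  proof -
    have "mismatches (\<lambda>y. y \<in> ?c ` T) (\<lambda>x. x \<in> ?c ` A) (?c ` X \<inter> nsets G ?j) (?c ` X \<inter> nsets G (Suc ?j)) =
          mismatches (\<lambda>y. G - y \<in> T) (\<lambda>x. G - x \<in> A) (?c ` X \<inter> nsets G ?j) (?c ` X \<inter> nsets G (Suc ?j))"
      unfolding mismatches_def using compl_mem_image_iff[OF AG(1)] compl_mem_image_iff[OF AG(2)]
      by (auto simp: nsets_def)
    thus ?thesis
      unfolding D_def l1[symmetric] l2[symmetric]
      using card_mismatches_compl[of "X \<inter> nsets G i" G "X \<inter> nsets G (Suc i)" "\<lambda>y. y \<in> T" "\<lambda>x. x \<in> A"] X_subset
      by auto
  qed
  moreover have "?c ` T \<subseteq> ?c ` X \<inter> nsets G ?j" "?c ` A \<subseteq> ?c ` X \<inter> nsets G (Suc ?j)"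
    unfolding l1[symmetric] l2[symmetric] using A T by auto
  moreover have "card (?c ` T) = card T" "card (?c ` A) = card A"
    by (intro card_image inj_on_compl AG)+
  moreover have "(\<Sum>y\<in>?c ` T. real (up_degree G (?c ` X) y) - p * real (n - ?j)) =
    (\<Sum>y\<in>T. real (down_degree X y) - p * real (Suc i))"
    unfolding j(4) using AG by (subst sum.reindex[OF inj_on_compl]) (auto simp: up_degree_compl intro!: sum.cong)
  ultimately show ?thesis
    using C.sum_up_degree_deviation[OF j(1,2), of "?c ` T" "?c ` A"] by simp
qed

text \<open>All edges leaving \<open>A\<close> end in \<open>T\<close>, so the edges below
  \<open>T\<close> are these and the \<open>D\<close> mismatches. Replacing the two degree sums by
  their means costs \<open>D / 10\<close> each, which leaves the coefficient 8 / 10, and 9 / 1000000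
  for every member of \<open>A\<close> and of \<open>T\<close>; by
  \<open>card T \<le> card A\<close> the latter adds up to at most 18 / 1000000 for every member of
  \<open>A\<close>.\<close>

lemma key_inequality:
  assumes i: "n \<le> 3 * i" "3 * i + 3 \<le> 2 * n"
    and A: "A \<subseteq> X \<inter> nsets G i" and T: "T \<subseteq> X \<inter> nsets G (Suc i)"
    and closed: "\<And>x y. x \<in> A \<Longrightarrow> y \<in> X \<inter> nsets G (Suc i) \<Longrightarrow> x \<subseteq> y \<Longrightarrow> y \<in> T"
    and le: "card T \<le> card A"
  defines "D \<equiv> card (mismatches (\<lambda>x. x \<in> A) (\<lambda>y. y \<in> T) (X \<inter> nsets G i) (X \<inter> nsets G (Suc i)))"
  shows "8 / 10 * D + p * real (n - i) * card A \<le> p * real (Suc i) * card T + 18 / 1000000 * card A"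
proof -
  let ?L = "X \<inter> nsets G i" and ?U = "X \<inter> nsets G (Suc i)"
  have fAT: "finite A" "finite T" using A T by (auto intro: finite_subset)
  have "(\<Sum>y\<in>T. down_degree X y) = (\<Sum>y\<in>T. card {x \<in> ?L. x \<subseteq> y})"
  proof (rule sum.cong[OF refl])
    fix y assume "y \<in> T"
    hence y: "y \<in> nsets G (Suc i)" using T by auto
    have "down_degree X y = card {l \<in> y. y - {l} \<in> ?L}"
      unfolding down_degree_def using y by (intro arg_cong[where f = card]) (auto simp: nsets_def)
    also have "\<dots> = card {x \<in> ?L. x \<subseteq> y}" using card_covered[OF finite_ground y, of ?L] by simp
    finally show "down_degree X y = card {x \<in> ?L. x \<subseteq> y}" .
  qed
  also have "\<dots> = card (SIGMA y:T. {x \<in> ?L. x \<subseteq> y})" using fAT by (subst card_SigmaI) auto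
  also have "\<dots> = card ((\<lambda>(y, x). (x, y)) ` (SIGMA y:T. {x \<in> ?L. x \<subseteq> y}))"
    by (rule card_image[symmetric]) (auto simp: inj_on_def)
  also have "(\<lambda>(y, x). (x, y)) ` (SIGMA y:T. {x \<in> ?L. x \<subseteq> y}) =
     (SIGMA x:A. {y \<in> ?U. x \<subseteq> y}) \<union> mismatches (\<lambda>x. x \<in> A) (\<lambda>y. y \<in> T) ?L ?U"
    using A T closed unfolding mismatches_def by (auto simp: image_iff)
  also have "card \<dots> = card (SIGMA x:A. {y \<in> ?U. x \<subseteq> y}) + D"
    unfolding D_def using closed fAT
    by (intro card_Un_disjoint finite_SigmaI finite_mismatches) (auto simp: mismatches_def)
  also have "card (SIGMA x:A. {y \<in> ?U. x \<subseteq> y}) = (\<Sum>x\<in>A. card {y \<in> ?U. x \<subseteq> y})"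
    using fAT by (subst card_SigmaI) auto
  also have "\<dots> = (\<Sum>x\<in>A. up_degree G X x)"
  proof (rule sum.cong[OF refl])
    fix x assume "x \<in> A"
    hence x: "x \<in> nsets G i" using A by auto
    have "up_degree G X x = card {l \<in> G - x. insert l x \<in> ?U}"
      unfolding up_degree_def using x by (intro arg_cong[where f = card]) (auto simp: nsets_def)
    also have "\<dots> = card {y \<in> ?U. x \<subseteq> y}" using card_covers[OF finite_ground x, of ?U] by simp
    finally show "card {y \<in> ?U. x \<subseteq> y} = up_degree G X x" by simp
  qed
  finally have *: "real (\<Sum>y\<in>T. down_degree X y) = real (\<Sum>x\<in>A. up_degree G X x) + D" by simp
  have arith: "8 / 10 * d + a \<le> b + (9 * s + 9 * t) / 1000000"
    if "\<bar>u - a\<bar> \<le> d / 10 + (s + 8 * t) / 1000000" "\<bar>v - b\<bar> \<le> d / 10 + (t + 8 * s) / 1000000" "v = u + d"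
    for a b d s t u v :: real
  proof -
    have "a - u \<le> d / 10 + (s + 8 * t) / 1000000" "v - b \<le> d / 10 + (t + 8 * s) / 1000000"
      using that by (simp_all add: abs_le_iff)
    thus ?thesis using that(3) by (simp add: field_simps)
  qed
  have "\<bar>real (\<Sum>x\<in>A. up_degree G X x) - card A * (p * real (n - i))\<bar> \<le> D / 10 + (real (card A) + 8 * real (card T)) / 1000000"
    using sum_up_degree_deviation[OF i A T] by (simp add: sum_subtractf D_def)
  moreover have "\<bar>real (\<Sum>y\<in>T. down_degree X y) - card T * (p * real (Suc i))\<bar> \<le> D / 10 + (real (card T) + 8 * real (card A)) / 1000000"
    using sum_down_degree_deviation[OF i A T] by (simp add: sum_subtractf D_def)
  ultimately have "8 / 10 * D + card A * (p * real (n - i)) \<le> card T * (p * real (Suc i)) + (9 * real (card A) + 9 * real (card T)) / 1000000"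
    using * by (rule arith)
  moreover have "(9 * real (card A) + 9 * real (card T)) / 1000000 \<le> 18 / 1000000 * real (card A)" using le by simp
  ultimately have "8 / 10 * D + card A * (p * real (n - i)) \<le> card T * (p * real (Suc i)) + 18 / 1000000 * real (card A)"
    by (rule order_trans[OF _ add_left_mono])
  thus ?thesis by (simp only: mult_ac)
qed

section \<open>Shadows below the middle and between the two middle levels\<close>

lemma finite_X: "finite X"
  using X_subset finite_ground by (meson finite_Pow_iff finite_subset)

lemma sum_up_degree_le:
  assumes A: "A \<subseteq> X \<inter> nsets G i" and T: "T \<subseteq> X \<inter> nsets G (Suc i)"
    and closed: "\<And>x y. x \<in> A \<Longrightarrow> y \<in> X \<inter> nsets G (Suc i) \<Longrightarrow> x \<subseteq> y \<Longrightarrow> y \<in> T"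
  shows "(\<Sum>x\<in>A. up_degree G X x) \<le> Suc i * card T"
proof -
  let ?U = "X \<inter> nsets G (Suc i)"
  have fAT: "finite A" "finite T" using A T by (auto intro: finite_subset)
  have "(\<Sum>x\<in>A. up_degree G X x) = (\<Sum>x\<in>A. card {y \<in> T. x \<subseteq> y})"
  proof (rule sum.cong[OF refl])
    fix x assume xA: "x \<in> A"
    hence x: "x \<in> nsets G i" using A by auto
    have "up_degree G X x = card {l \<in> G - x. insert l x \<in> ?U}"
      unfolding up_degree_def using x by (intro arg_cong[where f = card]) (auto simp: nsets_def)
    also have "\<dots> = card {y \<in> ?U. x \<subseteq> y}" using card_covers[OF finite_ground x, of ?U] by simp
    also have "{y \<in> ?U. x \<subseteq> y} = {y \<in> T. x \<subseteq> y}" using closed[OF xA] T by blast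
    finally show "up_degree G X x = card {y \<in> T. x \<subseteq> y}" .
  qed
  also have "\<dots> = card (SIGMA x:A. {y \<in> T. x \<subseteq> y})" using fAT by (subst card_SigmaI) auto
  also have "\<dots> = card ((\<lambda>(x, y). (y, x)) ` (SIGMA x:A. {y \<in> T. x \<subseteq> y}))"
    by (rule card_image[symmetric]) (auto simp: inj_on_def)
  also have "\<dots> \<le> card (SIGMA y:T. {x \<in> nsets G i. x \<subseteq> y})"
    using A fAT by (intro card_mono finite_SigmaI) auto
  also have "\<dots> = (\<Sum>y\<in>T. card {x \<in> nsets G i. x \<subseteq> y})" using fAT by (subst card_SigmaI) auto
  also have "\<dots> \<le> (\<Sum>y\<in>T. Suc i)"
  proof (rule sum_mono)
    fix y assume "y \<in> T"
    hence y: "y \<in> nsets G (Suc i)" using T by auto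
    have "card {l \<in> y. y - {l} \<in> nsets G i} \<le> card y" using y by (intro card_mono) (auto simp: nsets_def)
    thus "card {x \<in> nsets G i. x \<subseteq> y} \<le> Suc i"
      unfolding card_covered[OF finite_ground y order_refl] using y by (simp add: nsets_def)
  qed
  finally show ?thesis by (simp add: mult.commute)
qed

text \<open>If \<open>n \<le> 3 * i\<close> and the shadow were smaller,
  \<open>key_inequality\<close> would give
  \<open>p * (n - i) \<le> p * (i + 1) + 18 / 1000000\<close>; but \<open>n - i \<ge> i + 2\<close>,
  so \<open>p\<close> would be tiny. For smaller \<open>i\<close>, every up-degree is at least
  \<open>Suc i\<close>, the number of all lower neighbours of a set above.\<close>

lemma expansion:
  assumes i: "2 * i + 2 \<le> n" and A: "A \<subseteq> X \<inter> nsets G i"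
  shows "card A \<le> card (up_shadow (X \<inter> nsets G (Suc i)) A)" (is "_ \<le> card ?T")
proof (cases "n \<le> 3 * i")
  case True
  have T: "?T \<subseteq> X \<inter> nsets G (Suc i)" by (auto simp: up_shadow_def)
  show ?thesis
  proof (rule ccontr)
    assume "\<not> ?thesis"
    hence lt: "card ?T < card A" by simp
    let ?a = "real (card A)" and ?t = "real (card ?T)"
    have "3 * i + 3 \<le> 2 * n" using i by simp
    moreover have "y \<in> ?T" if "x \<in> A" "y \<in> X \<inter> nsets G (Suc i)" "x \<subseteq> y" for x y
      using that by (auto simp: up_shadow_def)
    ultimately have "p * real (n - i) * ?a \<le> p * real (Suc i) * ?t + 18 / 1000000 * ?a"
      by (rule order_trans[OF _ key_inequality[OF True _ A T _ less_imp_le[OF lt]], rotated]) auto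
    also have "p * real (Suc i) * ?t \<le> p * real (Suc i) * ?a"
      using p_ge lt by (intro mult_left_mono) auto
    finally have "p * real (n - i) * ?a \<le> (p * real (Suc i) + 18 / 1000000) * ?a" by (simp add: algebra_simps)
    hence "p * real (n - i) \<le> p * real (Suc i) + 18 / 1000000" using lt by simp
    moreover have "p * real (Suc (Suc i)) \<le> p * real (n - i)" using i p_ge by (intro mult_left_mono) auto
    ultimately show False using p_ge by (simp add: algebra_simps)
  qed
next
  case False
  have "Suc i * card A = (\<Sum>x\<in>A. Suc i)" by simp
  also have "\<dots> \<le> (\<Sum>x\<in>A. up_degree G X x)"
  proof (rule sum_mono)
    fix x assume "x \<in> A"
    hence x: "x \<subseteq> G" "card x = i" using A by (auto simp: nsets_def)
    show "Suc i \<le> up_degree G X x" using up_degree_ge[OF x(1)] x(2) False n_large by linarith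
  qed
  also have "\<dots> \<le> Suc i * card ?T" by (rule sum_up_degree_le[OF A]) (auto simp: up_shadow_def)
  finally show ?thesis by (subst (asm) nat_mult_le_cancel1) auto
qed

text \<open>Now \<open>n - k = Suc k\<close>, the main terms of \<open>key_inequality\<close> have
  equal coefficients, and a smaller shadow only makes \<open>D\<close> tiny compared with
  \<open>A\<close>. Since the upper level is at least as large as the lower one,
  \<open>?L - A\<close> is then smaller than \<open>?U - T\<close>, so their complements violate
  expansion in the complemented family with the same mismatches, and \<open>D\<close> is tiny
  compared with \<open>?U - T\<close> too. This contradicts isoperimetry.\<close>

lemma middle_expansion:
  assumes n: "n = 2 * k + 1" and le: "card (X \<inter> nsets G k) \<le> card (X \<inter> nsets G (Suc k))"
    and A: "A \<subseteq> X \<inter> nsets G k"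
  shows "card A \<le> card (up_shadow (X \<inter> nsets G (Suc k)) A)"
proof (rule ccontr)
  let ?L = "X \<inter> nsets G k" and ?U = "X \<inter> nsets G (Suc k)"
  define T where "T = up_shadow ?U A"
  define D where "D = card (mismatches (\<lambda>x. x \<in> A) (\<lambda>y. y \<in> T) ?L ?U)"
  assume "\<not> ?thesis"
  hence lt: "card T < card A" by (simp add: T_def)
  have T: "T \<subseteq> ?U" by (auto simp: T_def up_shadow_def)
  have closed: "y \<in> T" if "x \<in> A" "y \<in> ?U" "x \<subseteq> y" for x y using that by (auto simp: T_def up_shadow_def)
  have k: "n \<le> 3 * k" "3 * k + 3 \<le> 2 * n" "n - k = Suc k" "n - Suc k = k" using n n_large by auto
  have fin: "finite A" "finite T" "finite ?L" "finite ?U" using A T finite_X by (auto intro: finite_subset)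

  have iso: "min (card A) (card (?L - A)) \<le> 3120 * D"
    unfolding D_def by (rule min_card_le_mismatches[OF k(1,2) A T])
  have DA: "8 / 10 * real D \<le> 18 / 1000000 * card A"
  proof -
    have "8 / 10 * real D + p * real (Suc k) * card A \<le> p * real (Suc k) * card T + 18 / 1000000 * card A"
      using key_inequality[OF k(1,2) A T closed] lt k(3) unfolding D_def by simp
    moreover have "p * real (Suc k) * card T \<le> p * real (Suc k) * card A"
      using p_ge lt by (intro mult_left_mono) auto
    ultimately show ?thesis by linarith
  qed

  interpret C: typical_family G n "(-) G ` X" p by (rule typical_family_compl)
  let ?c = "(-) G" and ?A' = "(-) G ` (?U - T)" and ?T' = "(-) G ` (?L - A)"
  have l1: "?c ` ?U = ?c ` X \<inter> nsets G k" using compl_level[of "Suc k"] n k(4) by simp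
  have l2: "?c ` ?L = ?c ` X \<inter> nsets G (Suc k)" using compl_level[of k] n k(3) by simp
  have A': "?A' \<subseteq> ?c ` X \<inter> nsets G k" unfolding l1[symmetric] by auto
  have T': "?T' \<subseteq> ?c ` X \<inter> nsets G (Suc k)" unfolding l2[symmetric] by auto
  have sub: "?L \<subseteq> Pow G" "?U \<subseteq> Pow G" "?U - T \<subseteq> Pow G" "?L - A \<subseteq> Pow G" using X_subset by auto
  have cA': "card ?A' = card (?U - T)" and cT': "card ?T' = card (?L - A)"
    by (intro card_image inj_on_compl sub)+
  have less': "card (?L - A) < card (?U - T)"
  proof -
    have "card (?L - A) = card ?L - card A" "card (?U - T) = card ?U - card T"
      using A T fin by (auto intro: card_Diff_subset)
    moreover have "card A \<le> card ?L" using A fin by (intro card_mono) auto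
    ultimately show ?thesis using lt le by linarith
  qed
  have closed': "y \<in> ?T'" if xy: "x \<in> ?A'" "y \<in> ?c ` X \<inter> nsets G (Suc k)" "x \<subseteq> y" for x y
  proof -
    obtain x' where x': "x' \<in> ?U" "x' \<notin> T" "x = G - x'" using xy(1) by blast
    obtain y' where y': "y' \<in> ?L" "y = G - y'" using xy(2) unfolding l2[symmetric] by auto
    have "y' \<subseteq> x'" using xy(3) x' y' X_subset by auto
    hence "y' \<notin> A" using closed x' by blast
    thus ?thesis using y' by blast
  qed
  have D': "card (mismatches (\<lambda>x. x \<in> ?A') (\<lambda>y. y \<in> ?T') (?c ` X \<inter> nsets G k) (?c ` X \<inter> nsets G (Suc k))) = D"
  proof -
    have "mismatches (\<lambda>x. x \<in> ?A') (\<lambda>y. y \<in> ?T') (?c ` ?U) (?c ` ?L) =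
          mismatches (\<lambda>x. G - x \<notin> T) (\<lambda>y. G - y \<notin> A) (?c ` ?U) (?c ` ?L)"
    proof (rule mismatches_cong)
      fix x assume "x \<in> ?c ` ?U"
      hence "x \<subseteq> G" "G - x \<in> ?U" using compl_mem_image_iff[OF sub(2), of x] by auto
      thus "x \<in> ?A' \<longleftrightarrow> G - x \<notin> T" using compl_mem_image_iff[OF sub(3), of x] by simp
    next
      fix y assume "y \<in> ?c ` ?L"
      hence "y \<subseteq> G" "G - y \<in> ?L" using compl_mem_image_iff[OF sub(1), of y] by auto
      thus "y \<in> ?T' \<longleftrightarrow> G - y \<notin> A" using compl_mem_image_iff[OF sub(4), of y] by simp
    qed
    hence "card (mismatches (\<lambda>x. x \<in> ?A') (\<lambda>y. y \<in> ?T') (?c ` ?U) (?c ` ?L)) = card (mismatches (\<lambda>x. x \<notin> A) (\<lambda>y. y \<notin> T) ?L ?U)"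
      using card_mismatches_compl[OF sub(1,2), of "\<lambda>y. y \<notin> T" "\<lambda>x. x \<notin> A"] by simp
    also have "mismatches (\<lambda>x. x \<notin> A) (\<lambda>y. y \<notin> T) ?L ?U = mismatches (\<lambda>x. x \<in> A) (\<lambda>y. y \<in> T) ?L ?U"
      by (auto simp: mismatches_def)
    finally show ?thesis unfolding l1 l2 D_def .
  qed
  have DB: "8 / 10 * real D \<le> 18 / 1000000 * card (?U - T)"
  proof -
    have "8 / 10 * real D + p * real (Suc k) * card (?U - T) \<le> p * real (Suc k) * card (?L - A) + 18 / 1000000 * card (?U - T)"
      using C.key_inequality[OF k(1,2) A' T' closed'] less' k(3) unfolding D' cA' cT' by simp
    moreover have "p * real (Suc k) * card (?L - A) \<le> p * real (Suc k) * card (?U - T)"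
      using p_ge less' by (intro mult_left_mono) auto
    ultimately show ?thesis by linarith
  qed
  \<comment> \<open>Isoperimetry speaks of \<open>?L - A\<close>, so \<open>?U - T\<close> has to be
    bounded by it. In the complemented family every up-degree is at least half of
    \<open>Suc k\<close>, and a set has at most \<open>Suc k\<close> lower neighbours.\<close>
  have "card (?U - T) \<le> 2 * card (?L - A)"
  proof -
    have "Suc k * card ?A' = (\<Sum>x\<in>?A'. Suc k)" by simp
    also have "\<dots> \<le> (\<Sum>x\<in>?A'. 2 * up_degree G (?c ` X) x)"
    proof (rule sum_mono)
      fix x assume "x \<in> ?A'"
      hence x: "x \<subseteq> G" "card x = k" using A' by (auto simp: nsets_def)
      show "Suc k \<le> 2 * up_degree G (?c ` X) x" using C.up_degree_ge[OF x(1)] x(2) n n_large by linarith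
    qed
    also have "\<dots> = 2 * (\<Sum>x\<in>?A'. up_degree G (?c ` X) x)" by (rule sum_distrib_left[symmetric])
    also have "\<dots> \<le> 2 * (Suc k * card ?T')"
      by (intro mult_left_mono C.sum_up_degree_le[OF A' T'] closed') auto
    finally have "Suc k * card ?A' \<le> Suc k * (2 * card ?T')" by (simp only: mult_ac)
    thus ?thesis unfolding cA' cT' by (subst (asm) nat_mult_le_cancel1) auto
  qed
  hence "real (card (?U - T)) \<le> 2 * real (card (?L - A))" by linarith
  moreover have "real (card A) \<le> 3120 * real D \<or> real (card (?L - A)) \<le> 3120 * real D"
    using iso by (auto simp: min_def split: if_splits)
  \<comment> \<open>The factor \<open>3120 * 18 / 800000\<close> is below 0.08, and below 1 even
    when doubled. So \<open>A\<close> or \<open>?L - A\<close> is empty; the former contradicts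
    \<open>lt\<close>, the latter empties \<open>?U - T\<close> and contradicts
    \<open>less'\<close>.\<close>
  ultimately show False using DA DB lt less' by linarith
qed

section \<open>Pushing antichains to the middle and the width\<close>

text \<open>Level by level, the lowest sets are replaced by their shadow, which is no smaller by
  \<open>expansion\<close>. The clause on \<open>m\<close> says that no set grows beyond an upper
  bound already valid, so that a second push in the complemented family does not undo the
  first.\<close>

lemma push_up:
  assumes F: "F \<subseteq> X" "antichain F" and j: "2 * j \<le> n"
  shows "\<exists>F'\<subseteq>X. antichain F' \<and> card F \<le> card F' \<and> (\<forall>x\<in>F'. j \<le> card x) \<and>
    (\<forall>m\<ge>j. (\<forall>x\<in>F. card x \<le> m) \<longrightarrow> (\<forall>x\<in>F'. card x \<le> m))"
  using j
proof (induction j)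
  case 0
  show ?case using F by (intro exI[of _ F]) auto
next
  case (Suc j)
  then obtain F' where F': "F' \<subseteq> X" "antichain F'" "card F \<le> card F'" "\<And>x. x \<in> F' \<Longrightarrow> j \<le> card x"
    "\<And>m x. j \<le> m \<Longrightarrow> \<forall>x\<in>F. card x \<le> m \<Longrightarrow> x \<in> F' \<Longrightarrow> card x \<le> m"
    by auto
  let ?U = "X \<inter> nsets G (Suc j)"
  define A where "A = F' \<inter> nsets G j"
  define T where "T = up_shadow ?U A"
  have AT: "card A \<le> card T" unfolding T_def A_def using Suc.prems F' by (intro expansion) auto
  have fin: "finite F'" "finite T"
    using F' finite_X by (auto intro: finite_subset simp: T_def up_shadow_def)
  have eq: "u = v" if "u \<in> F'" "v \<in> F'" "u \<subseteq> v" for u v using F'(2) that by (auto simp: antichain_iff)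
  have FG: "x \<subseteq> G" "finite x" if "x \<in> F'" for x
    using that F'(1) X_subset finite_subset[OF _ finite_ground] by blast+
  have FA: "Suc j \<le> card x" if "x \<in> F' - A" for x
    using that F'(4)[of x] FG[of x] by (auto simp: A_def nsets_def)
  have Tc: "card y = Suc j" "finite y" "y \<in> X" if "y \<in> T" for y using that by (auto simp: T_def up_shadow_def nsets_def)
  have Tx: "\<exists>x\<in>A. x \<subseteq> y" if "y \<in> T" for y using that by (auto simp: T_def up_shadow_def)
  have disj: "(F' - A) \<inter> T = {}"
  proof (rule equals0I)
    fix y assume y: "y \<in> (F' - A) \<inter> T"
    then obtain x where "x \<in> A" "x \<subseteq> y" using Tx by auto
    thus False using eq[of x y] y by (auto simp: A_def)
  qed
  show ?case
  proof (intro exI[of _ "(F' - A) \<union> T"] conjI ballI allI impI)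
    show "F' - A \<union> T \<subseteq> X" using F' by (auto simp: T_def up_shadow_def)
    show "antichain (F' - A \<union> T)" unfolding antichain_iff
    proof (intro ballI impI)
      fix u v assume uv: "u \<in> F' - A \<union> T" "v \<in> F' - A \<union> T" "u \<subseteq> v"
      show "u = v"
      proof (cases "v \<in> T")
        case True
        have "Suc j \<le> card u" using uv(1) FA Tc by force
        thus ?thesis using Tc[OF True] uv(3) by (intro card_seteq) auto
      next
        case False
        hence v: "v \<in> F' - A" using uv by auto
        show ?thesis
        proof (cases "u \<in> T")
          case True
          then obtain x where "x \<in> A" "x \<subseteq> u" using Tx by auto
          thus ?thesis using eq[of x v] uv v by (auto simp: A_def)
        qed (use eq uv v in auto)
      qed
    qed
    have "card F' = card A + card (F' - A)"
      using fin card_Int_Diff[of F' "nsets G j"] by (simp add: A_def Diff_Int2 Diff_Int)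
    moreover have "card (F' - A \<union> T) = card (F' - A) + card T"
      using fin disj by (intro card_Un_disjoint) auto
    ultimately show "card F \<le> card (F' - A \<union> T)" using AT F'(3) by linarith
    show "Suc j \<le> card x" if "x \<in> F' - A \<union> T" for x using that FA Tc by force
    show "card x \<le> m" if "Suc j \<le> m" "\<forall>x\<in>F. card x \<le> m" "x \<in> F' - A \<union> T" for m x
      using F'(5)[of m x] that Tc[of x] by auto
  qed
qed

text \<open>The members of size \<open>k\<close> are traded for their shadow. It is no smaller by
  \<open>middle_expansion\<close> and, \<open>F\<close> being an antichain, disjoint from the
  members of size \<open>Suc k\<close>, so everything fits into one level.\<close>

lemma antichain_two_levels:
  assumes n: "n = 2 * k + 1" and le: "card (X \<inter> nsets G k) \<le> card (X \<inter> nsets G (Suc k))"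
    and F: "F \<subseteq> X" "antichain F" "\<And>x. x \<in> F \<Longrightarrow> card x = k \<or> card x = Suc k"
  shows "card F \<le> card (X \<inter> nsets G (Suc k))"
proof -
  let ?U = "X \<inter> nsets G (Suc k)" and ?A = "F \<inter> nsets G k" and ?B = "F \<inter> nsets G (Suc k)"
  have fin: "finite F" using F(1) finite_X by (rule finite_subset)
  have "x \<subseteq> G" "finite x" if "x \<in> F" for x
    using that F(1) X_subset finite_subset[OF _ finite_ground] by blast+
  hence "F \<subseteq> ?A \<union> ?B" using F(3) by (auto simp: nsets_def)
  hence "card F \<le> card (?A \<union> ?B)" using fin by (intro card_mono) auto
  also have "\<dots> \<le> card ?A + card ?B" by (rule card_Un_le)
  also have "card ?A \<le> card (up_shadow ?U ?A)" using F by (intro middle_expansion[OF n le]) auto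
  also have "card (up_shadow ?U ?A) + card ?B = card (up_shadow ?U ?A \<union> ?B)"
  proof (rule card_Un_disjoint[symmetric])
    show "up_shadow ?U ?A \<inter> ?B = {}"
    proof (rule equals0I)
      fix y assume y: "y \<in> up_shadow ?U ?A \<inter> ?B"
      then obtain x where "x \<in> ?A" "x \<subseteq> y" by (auto simp: up_shadow_def)
      moreover from this have "x = y" using F(2) y by (auto simp: antichain_iff)
      ultimately show False using y by (auto simp: nsets_def)
    qed
  qed (use fin finite_X in \<open>auto simp: up_shadow_def\<close>)
  also have "\<dots> \<le> card ?U" using F finite_X by (intro card_mono) (auto simp: up_shadow_def)
  finally show ?thesis by simp
qed

text \<open>A first push brings all sizes to at least \<open>k = n div 2\<close>; a push of the
  complements also bounds the sizes from the other side, by \<open>n - k\<close>. One level is left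
  if \<open>n\<close> is even. If \<open>n\<close> is odd, two are left, and
  \<open>antichain_two_levels\<close> is applied to \<open>X\<close> or to the complemented family,
  according to which has the larger middle level on top.\<close>

lemma antichain_card_le:
  assumes F: "F \<subseteq> X" "antichain F"
  shows "card F \<le> max (card (X \<inter> nsets G (n div 2))) (card (X \<inter> nsets G ((n + 1) div 2)))"
proof -
  interpret C: typical_family G n "(-) G ` X" p by (rule typical_family_compl)
  define k where "k = n div 2"
  have k: "2 * k \<le> n" "k \<le> n - k" by (auto simp: k_def)
  have anti: "antichain ((-) G ` F)" if "antichain F" "F \<subseteq> Pow G" for F
    unfolding antichain_iff
  proof (intro ballI impI)
    fix u v assume "u \<in> (-) G ` F" "v \<in> (-) G ` F" "u \<subseteq> v"
    then obtain u' v' where u': "u' \<in> F" "v' \<in> F" "u = G - u'" "v = G - v'" by auto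
    hence "v' \<subseteq> u'" using \<open>u \<subseteq> v\<close> that(2) by auto
    thus "u = v" using that(1) u' by (auto simp: antichain_iff)
  qed
  obtain F1 where F1: "F1 \<subseteq> X" "antichain F1" "card F \<le> card F1" "\<And>x. x \<in> F1 \<Longrightarrow> k \<le> card x"
    using push_up[OF F k(1)] by auto
  have F1G: "F1 \<subseteq> Pow G" using F1 X_subset by auto
  have up: "card x \<le> n - k" if x: "x \<in> (-) G ` F1" for x
  proof -
    obtain y where y: "y \<in> F1" "x = G - y" using x by auto
    hence "y \<subseteq> G" using F1G by auto
    hence "card x = n - card y"
      using y card_ground finite_ground by (simp add: card_Diff_subset finite_subset)
    thus ?thesis using F1(4)[OF y(1)] by simp
  qed
  have "(-) G ` F1 \<subseteq> (-) G ` X" using F1 by auto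
  then obtain F2 where F2: "F2 \<subseteq> (-) G ` X" "antichain F2" "card ((-) G ` F1) \<le> card F2" "\<And>x. x \<in> F2 \<Longrightarrow> k \<le> card x"
    "\<forall>m\<ge>k. (\<forall>x\<in>(-) G ` F1. card x \<le> m) \<longrightarrow> (\<forall>x\<in>F2. card x \<le> m)"
    using C.push_up[OF _ anti[OF F1(2) F1G] k(1)] by auto
  have F2_le: "card x \<le> n - k" if "x \<in> F2" for x
    using F2(5) k(2) up that by blast
  have F2G: "F2 \<subseteq> Pow G" using F2 C.X_subset by auto
  have "card F \<le> card F2" using F1(3) F2(3) card_image[OF inj_on_compl[OF F1G]] by simp
  also have "\<dots> \<le> max (card (X \<inter> nsets G k)) (card (X \<inter> nsets G (n - k)))"
  proof (cases "even n")
    case True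
    hence nk: "n - k = k" by (auto simp: k_def)
    have "F2 \<subseteq> (-) G ` (X \<inter> nsets G k)"
      unfolding compl_level[OF order_trans[OF k(2) diff_le_self]] nk
    proof
      fix x assume x: "x \<in> F2"
      hence "x \<subseteq> G" using F2G by auto
      thus "x \<in> (-) G ` X \<inter> nsets G k"
        using F2(1) F2(4)[OF x] F2_le[OF x] x nk finite_subset[OF _ finite_ground] by (auto simp: nsets_def)
    qed
    hence "card F2 \<le> card (X \<inter> nsets G k)" by (rule surj_card_le[rotated]) simp
    thus ?thesis by simp
  next
    case False
    hence n: "n = 2 * k + 1" "n - k = Suc k" "n - Suc k = k" by (auto simp: k_def elim!: oddE)
    have cl: "card ((-) G ` X \<inter> nsets G k) = card (X \<inter> nsets G (Suc k))"
      "card ((-) G ` X \<inter> nsets G (Suc k)) = card (X \<inter> nsets G k)"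
      using compl_level[of "Suc k"] compl_level[of k] n X_subset
        card_image[OF inj_on_compl, of "X \<inter> nsets G k" G] card_image[OF inj_on_compl, of "X \<inter> nsets G (Suc k)" G]
      by (simp_all add: le_infI1)
    have lev: "card x = k \<or> card x = Suc k" if "x \<in> F2" for x using F2(4)[OF that] F2_le[OF that] n by linarith
    show ?thesis
    proof (cases "card (X \<inter> nsets G k) \<le> card (X \<inter> nsets G (Suc k))")
      case True
      have "card F2 = card ((-) G ` F2)" by (rule card_image[symmetric, OF inj_on_compl[OF F2G]])
      also have "\<dots> \<le> card (X \<inter> nsets G (Suc k))"
      proof (rule antichain_two_levels[OF n(1) True])
        show "(-) G ` F2 \<subseteq> X"
          using F2(1) F2G compl_mem_image_iff[OF X_subset] by (intro image_subsetI) blast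
        show "antichain ((-) G ` F2)" by (rule anti[OF F2(2) F2G])
        fix x assume "x \<in> (-) G ` F2"
        then obtain y where y: "y \<in> F2" "x = G - y" by auto
        hence "card x = n - card y" using F2G finite_ground card_ground by (auto simp: card_Diff_subset finite_subset)
        thus "card x = k \<or> card x = Suc k" using lev[OF y(1)] n by auto
      qed
      finally show ?thesis using n by simp
    next
      case False
      hence "card F2 \<le> card (X \<inter> nsets G k)"
        using C.antichain_two_levels[OF n(1) _ F2(1,2) lev] unfolding cl by simp
      thus ?thesis by simp
    qed
  qed
  also have "n - k = (n + 1) div 2" unfolding k_def by linarith
  finally show ?thesis by (simp add: k_def)
qed

lemma width_eq:
  "width X = max (card (X \<inter> nsets G (n div 2))) (card (X \<inter> nsets G ((n + 1) div 2)))"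
proof -
  have anti: "antichain (X \<inter> nsets G i)" for i
    unfolding antichain_iff
  proof (intro ballI impI)
    fix u v assume "u \<in> X \<inter> nsets G i" "v \<in> X \<inter> nsets G i" "u \<subseteq> v"
    thus "u = v" by (intro card_subset_eq) (auto simp: nsets_def)
  qed
  let ?S = "{card F |F. F \<subseteq> X \<and> antichain F}"
  have "finite ?S" using finite_X by simp
  moreover have "max (card (X \<inter> nsets G (n div 2))) (card (X \<inter> nsets G ((n + 1) div 2))) \<in> ?S"
    using anti by (auto simp: max_def)
  ultimately show ?thesis unfolding width_def
    using antichain_card_le by (intro Max_eqI) auto
qed

end

section \<open>Random families are typical\<close>

lemma Hoeffding_bernoulli:
  fixes c :: "'a \<Rightarrow> real"
  assumes F: "finite F" and p: "0 \<le> p" "p \<le> 1" and s: "0 \<le> s" and V: "(\<Sum>y\<in>F. (c y)\<^sup>2) \<le> V"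
  shows "measure_pmf.prob (Pi_pmf F False (\<lambda>_. bernoulli_pmf p))
           {g. s < \<bar>\<Sum>y\<in>F. c y * (of_bool (g y) - p)\<bar>} \<le> 2 * exp (- 2 * s\<^sup>2 / V)"
\<comment> \<open>Hoeffding's inequality is applied with a positive sum of squares. If the sum is 0,
  all coefficients vanish and the strict inequality in the event never holds.\<close>
proof (cases "(\<Sum>y\<in>F. (c y)\<^sup>2) = 0")
  case True
  hence "c y = 0" if "y \<in> F" for y using that F by (subst (asm) sum_nonneg_eq_0_iff) auto
  hence "{g. s < \<bar>\<Sum>y\<in>F. c y * (of_bool (g y) - p)\<bar>} = {}" using s by simp
  thus ?thesis by (simp only: measure_empty) simp
next
  case False
  define M where "M = Pi_pmf F False (\<lambda>_. bernoulli_pmf p)"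
  have V0: "0 < (\<Sum>y\<in>F. (c y)\<^sup>2)" using False by (simp add: order_less_le sum_nonneg)
  have E: "measure_pmf.expectation M (\<lambda>g. c y * of_bool (g y)) = c y * p" if "y \<in> F" for y
  proof -
    have "measure_pmf.expectation M (\<lambda>g. c y * of_bool (g y)) =
        measure_pmf.expectation (map_pmf (\<lambda>g. g y) M) (\<lambda>b. c y * of_bool b)" by simp
    also have "map_pmf (\<lambda>g. g y) M = bernoulli_pmf p"
      unfolding M_def using that F by (simp add: Pi_pmf_component)
    finally show ?thesis using p by simp
  qed
  interpret Hoeffding_ineq "measure_pmf M" F "\<lambda>y g. c y * of_bool (g y)" "\<lambda>y. min 0 (c y)" "\<lambda>y. max 0 (c y)"
     "\<Sum>y\<in>F. measure_pmf.expectation M (\<lambda>g. c y * of_bool (g y))"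
  proof unfold_locales
    show "finite F" by fact
    show "prob_space.indep_vars (measure_pmf M) (\<lambda>_. borel) (\<lambda>y g. c y * of_bool (g y)) F"
      unfolding M_def
      by (rule prob_space.indep_vars_compose2[OF measure_pmf.prob_space_axioms indep_vars_Pi_pmf[OF F]]) auto
  qed (auto simp: min_def max_def)
  have sq: "(\<Sum>y\<in>F. (max 0 (c y) - min 0 (c y))\<^sup>2) = (\<Sum>y\<in>F. (c y)\<^sup>2)"
    by (intro sum.cong) (auto simp: max_def min_def)
  have mu: "(\<Sum>y\<in>F. measure_pmf.expectation M (\<lambda>g. c y * of_bool (g y))) = (\<Sum>y\<in>F. c y * p)"
    by (intro sum.cong E refl)
  have "measure_pmf.prob M {g. s < \<bar>\<Sum>y\<in>F. c y * (of_bool (g y) - p)\<bar>} \<le>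
        measure_pmf.prob M {g \<in> space M. s \<le> \<bar>(\<Sum>y\<in>F. c y * of_bool (g y)) - (\<Sum>y\<in>F. c y * p)\<bar>}"
    by (intro measure_pmf.finite_measure_mono) (auto simp: right_diff_distrib sum_subtractf)
  also have "\<dots> \<le> 2 * exp (- 2 * s\<^sup>2 / (\<Sum>y\<in>F. (c y)\<^sup>2))"
    using Hoeffding_ineq_abs_ge[OF s] V0 unfolding sq mu by simp
  also have "\<dots> \<le> 2 * exp (- 2 * s\<^sup>2 / V)"
    using V V0 by (auto intro!: divide_left_mono mult_pos_pos)
  finally show ?thesis unfolding M_def .
qed

text \<open>By Fubini, the probability is the average over the first component of the conditional
  ones.\<close>

lemma prob_pair_pmf_le:
  assumes "\<And>x. measure_pmf.prob B {y. (x, y) \<in> S} \<le> c" "0 \<le> c"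
  shows "measure_pmf.prob (pair_pmf A B) S \<le> c"
proof -
  have "emeasure (pair_pmf A B) S = (\<integral>\<^sup>+x. indicator S x \<partial>pair_pmf A B)" by simp
  also have "\<dots> = (\<integral>\<^sup>+a. \<integral>\<^sup>+b. indicator S (a, b) \<partial>B \<partial>A)" by (rule nn_integral_pair_pmf')
  also have "\<dots> = (\<integral>\<^sup>+a. emeasure B {b. (a, b) \<in> S} \<partial>A)"
  proof (rule nn_integral_cong)
    fix a
    have "(\<integral>\<^sup>+b. indicator S (a, b) \<partial>B) = (\<integral>\<^sup>+b. indicator {b. (a, b) \<in> S} b \<partial>B)"
      by (intro nn_integral_cong) (simp add: indicator_def)
    thus "(\<integral>\<^sup>+b. indicator S (a, b) \<partial>B) = emeasure B {b. (a, b) \<in> S}" by simp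
  qed
  also have "\<dots> \<le> (\<integral>\<^sup>+a. ennreal c \<partial>A)"
    using assms by (intro nn_integral_mono) (simp add: measure_pmf.emeasure_eq_measure ennreal_leI)
  also have "\<dots> = ennreal c" by simp
  finally show ?thesis using assms(2) by (simp add: measure_pmf.emeasure_eq_measure)
qed

text \<open>Conditioning on the coordinates in \<open>F0\<close> makes the sum linear in the independent
  coordinates in \<open>F1\<close>.\<close>

lemma bipartite_concentration:
  assumes fin: "finite W" and F: "F0 \<subseteq> W" "F1 \<subseteq> W - F0" and p: "0 \<le> p" "p \<le> 1" and s: "0 \<le> s"
    and row: "\<And>x. x \<in> F0 \<Longrightarrow> card {y \<in> F1. R x y} \<le> d"
    and col: "\<And>y. y \<in> F1 \<Longrightarrow> card {x \<in> F0. R x y} \<le> d"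
  shows "measure_pmf.prob (Pi_pmf W False (\<lambda>_. bernoulli_pmf p))
     {f. s < \<bar>\<Sum>x | x \<in> F0 \<and> f x. \<Sum>y | y \<in> F1 \<and> R x y. of_bool (f y) - p\<bar>}
     \<le> 2 * exp (- 2 * s\<^sup>2 / (real d ^ 2 * card F0))"
proof -
  have fin': "finite F0" "finite (W - F0)" "finite F1" using fin F by (auto intro: finite_subset)
  let ?B = "\<lambda>_. bernoulli_pmf p" and ?h = "\<lambda>(f, g) x. if x \<in> F0 then f x else g x"
  let ?E = "{f. s < \<bar>\<Sum>x | x \<in> F0 \<and> f x. \<Sum>y | y \<in> F1 \<and> R x y. of_bool (f y) - p\<bar>}"
  have "Pi_pmf W False ?B = Pi_pmf (F0 \<union> (W - F0)) False ?B" using F by (simp add: Un_absorb1)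
  also have "\<dots> = map_pmf ?h (pair_pmf (Pi_pmf F0 False ?B) (Pi_pmf (W - F0) False ?B))"
    by (rule Pi_pmf_union) (use fin' in auto)
  finally have "measure_pmf.prob (Pi_pmf W False ?B) ?E =
     measure_pmf.prob (pair_pmf (Pi_pmf F0 False ?B) (Pi_pmf (W - F0) False ?B)) (?h -` ?E)"
    by simp
  also have "\<dots> \<le> 2 * exp (- 2 * s\<^sup>2 / (real d ^ 2 * card F0))"
  proof (rule prob_pair_pmf_le)
    fix f
    define S where "S = {x \<in> F0. f x}"
    \<comment> \<open>With the bits in \<open>F0\<close> fixed, \<open>c y\<close> is the
      coefficient of the bit at \<open>y\<close>, and it is 0 off \<open>F1\<close>. As
      \<open>c y \<le> d\<close>, the squares add up to at most \<open>d\<close> times the number of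
      edges between \<open>S\<close> and \<open>F1\<close>, which is at most
      \<open>d * card F0\<close>.\<close>
    define c where "c = (\<lambda>y. if y \<in> F1 then card {x \<in> S. R x y} else 0)"
    have fS: "finite S" using fin' by (simp add: S_def)
    have cd: "c y \<le> d" for y
    proof (cases "y \<in> F1")
      case True
      have "card {x \<in> S. R x y} \<le> card {x \<in> F0. R x y}" using fin' by (intro card_mono) (auto simp: S_def)
      thus ?thesis using col[OF True] True by (simp add: c_def)
    qed (simp add: c_def)
    have "(\<Sum>y\<in>W - F0. (c y)\<^sup>2) \<le> (\<Sum>y\<in>W - F0. d * c y)"
      using cd by (intro sum_mono) (simp add: power2_eq_square)
    also have "\<dots> = d * (\<Sum>y\<in>F1. card {x \<in> S. R x y})"
      unfolding sum_distrib_left[symmetric] using F fin'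
      by (intro arg_cong[where f = "(*) d"] sum.mono_neutral_cong_right) (auto simp: c_def)
    also have "(\<Sum>y\<in>F1. card {x \<in> S. R x y}) = (\<Sum>x\<in>S. card {y \<in> F1. R x y})"
      using sum.swap_restrict[OF fS fin'(3), of "\<lambda>_ _. 1::nat" R] by simp
    also have "\<dots> \<le> (\<Sum>x\<in>S. d)" using row by (intro sum_mono) (auto simp: S_def)
    also have "\<dots> \<le> card F0 * d" using fin' by (auto intro!: card_mono simp: S_def)
    finally have "real (\<Sum>y\<in>W - F0. (c y)\<^sup>2) \<le> real (d * (card F0 * d))" by (intro of_nat_mono) simp
    hence V: "(\<Sum>y\<in>W - F0. (real (c y))\<^sup>2) \<le> real d ^ 2 * card F0"
      by (simp add: power2_eq_square mult_ac)
    have eq: "(\<Sum>x | x \<in> F0 \<and> ?h (f, g) x. \<Sum>y | y \<in> F1 \<and> R x y. of_bool (?h (f, g) y) - p) =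
          (\<Sum>y\<in>W - F0. real (c y) * (of_bool (g y) - p))" for g
    proof -
      have "(\<Sum>x | x \<in> F0 \<and> ?h (f, g) x. \<Sum>y | y \<in> F1 \<and> R x y. of_bool (?h (f, g) y) - p) =
            (\<Sum>x\<in>S. \<Sum>y | y \<in> F1 \<and> R x y. of_bool (g y) - p)"
        using F by (intro sum.cong) (auto simp: S_def)
      also have "\<dots> = (\<Sum>y\<in>F1. \<Sum>x | x \<in> S \<and> R x y. of_bool (g y) - p)"
        by (rule sum.swap_restrict[OF fS fin'(3)])
      also have "\<dots> = (\<Sum>y\<in>W - F0. real (c y) * (of_bool (g y) - p))"
        using F fin' by (intro sum.mono_neutral_cong_left) (auto simp: c_def)
      finally show ?thesis .
    qed
    have "{g. (f, g) \<in> ?h -` ?E} = {g. s < \<bar>\<Sum>y\<in>W - F0. real (c y) * (of_bool (g y) - p)\<bar>}"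
      unfolding vimage_def mem_Collect_eq eq ..
    thus "measure_pmf.prob (Pi_pmf (W - F0) False ?B) {g. (f, g) \<in> ?h -` ?E} \<le> 2 * exp (- 2 * s\<^sup>2 / (real d ^ 2 * card F0))"
      using Hoeffding_bernoulli[OF fin'(2) p s V] by simp
  qed simp
  finally show ?thesis .
qed

section \<open>Union bounds over the cube\<close>

lemma prob_all_False:
  assumes "finite W" "S \<subseteq> W" "0 \<le> p" "p \<le> 1"
  shows "measure_pmf.prob (Pi_pmf W False (\<lambda>_. bernoulli_pmf p)) {f. \<forall>x\<in>S. \<not> f x} = (1 - p) ^ card S"
proof -
  have "{f. \<forall>x\<in>S. \<not> f x} = Pi W (\<lambda>x. if x \<in> S then {False} else UNIV)"
    using assms(2) by (auto simp: Pi_def split: if_splits)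
  hence "measure_pmf.prob (Pi_pmf W False (\<lambda>_. bernoulli_pmf p)) {f. \<forall>x\<in>S. \<not> f x} =
     (\<Prod>x\<in>W. measure_pmf.prob (bernoulli_pmf p) (if x \<in> S then {False} else UNIV))"
    using measure_Pi_pmf_Pi[OF assms(1)] by simp
  also have "\<dots> = (\<Prod>x\<in>S. 1 - p)"
    using assms by (intro prod.mono_neutral_cong_right) (auto simp: measure_pmf_single split: if_splits)
  finally show ?thesis by simp
qed

lemma prob_UN_le:
  fixes c :: real
  assumes "finite I" "\<And>i. i \<in> I \<Longrightarrow> measure_pmf.prob M (E i) \<le> c"
  shows "measure_pmf.prob M (\<Union>i\<in>I. E i) \<le> card I * c"
proof -
  have "measure_pmf.prob M (\<Union>i\<in>I. E i) \<le> (\<Sum>i\<in>I. measure_pmf.prob M (E i))"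
    using assms by (intro measure_UNION_le) auto
  also have "\<dots> \<le> (\<Sum>i\<in>I. c)" using assms by (intro sum_mono) auto
  finally show ?thesis by simp
qed

text \<open>This is a union bound over \<open>v\<close> and the set \<open>S\<close> of directions
  leading to missing neighbours, at most \<open>4 ^ n\<close> choices. By injectivity these are
  \<open>card S\<close> different sets, all absent with probability at most
  \<open>(1 / 8) ^ (K * card S)\<close>, which is at most \<open>(1 / 8) ^ n\<close>. The parameters
  \<open>D\<close> and \<open>h\<close> allow both insertion and removal of an element.\<close>

lemma prob_many_missing:
  fixes h :: "'a set \<Rightarrow> 'a \<Rightarrow> 'a set"
  assumes G: "finite G" "card G = n" and p: "p \<le> 1" "1 - p \<le> (1 / 8) ^ K"
    and h: "\<And>v. v \<subseteq> G \<Longrightarrow> D v \<subseteq> G" "\<And>v. v \<subseteq> G \<Longrightarrow> inj_on (h v) (D v)"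
      "\<And>v. v \<subseteq> G \<Longrightarrow> h v ` D v \<subseteq> Pow G"
  shows "measure_pmf.prob (Pi_pmf (Pow G) False (\<lambda>_. bernoulli_pmf p))
    {f. \<exists>v\<in>Pow G. n < K * card {l \<in> D v. \<not> f (h v l)}} \<le> (1 / 2) ^ n" (is "measure_pmf.prob ?M ?B \<le> _")
proof -
  have p0: "0 \<le> p"
  proof -
    have "(1 / 8 :: real) ^ K \<le> 1" by (rule power_le_one) auto
    thus ?thesis using p by linarith
  qed
  define I where "I = {(v, S). v \<subseteq> G \<and> S \<subseteq> D v \<and> n < K * card S}"
  have I_sub: "I \<subseteq> Pow G \<times> Pow G" using h(1) unfolding I_def by blast
  have fI: "finite I" using I_sub G by (intro finite_subset[OF I_sub]) auto
  have "card I \<le> card (Pow G \<times> Pow G)" using I_sub G by (intro card_mono) auto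
  also have "\<dots> = 4 ^ n" using G by (simp add: card_cartesian_product card_Pow power_mult_distrib[symmetric])
  finally have cI: "real (card I) \<le> 4 ^ n" by (metis of_nat_le_iff of_nat_numeral of_nat_power)
  have "?B \<subseteq> (\<Union>i\<in>I. {f. \<forall>x\<in>h (fst i) ` snd i. \<not> f x})"
  proof
    fix f assume "f \<in> ?B"
    then obtain v where v: "v \<subseteq> G" "n < K * card {l \<in> D v. \<not> f (h v l)}" by auto
    hence "(v, {l \<in> D v. \<not> f (h v l)}) \<in> I" by (auto simp: I_def)
    thus "f \<in> (\<Union>i\<in>I. {f. \<forall>x\<in>h (fst i) ` snd i. \<not> f x})" by (rule UN_I) auto
  qed
  hence "measure_pmf.prob ?M ?B \<le> measure_pmf.prob ?M (\<Union>i\<in>I. {f. \<forall>x\<in>h (fst i) ` snd i. \<not> f x})"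
    by (intro measure_pmf.finite_measure_mono) auto
  also have "\<dots> \<le> card I * (1 / 8) ^ n"
  proof (rule prob_UN_le[OF fI])
    fix i assume i: "i \<in> I"
    obtain v S where vS: "i = (v, S)" by fastforce
    have *: "v \<subseteq> G" "S \<subseteq> D v" "n < K * card S" using i vS by (auto simp: I_def)
    have "measure_pmf.prob ?M {f. \<forall>x\<in>h v ` S. \<not> f x} = (1 - p) ^ card (h v ` S)"
      using G p p0 h(3)[OF *(1)] *(2) by (intro prob_all_False) auto
    also have "card (h v ` S) = card S"
      using h(2)[OF *(1)] *(2) by (intro card_image) (rule inj_on_subset)
    also have "(1 - p) ^ card S \<le> ((1 / 8) ^ K) ^ card S" using p by (intro power_mono) auto
    also have "\<dots> \<le> (1 / 8) ^ n"
      unfolding power_mult[symmetric] using *(3) by (intro power_decreasing) auto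
    finally show "measure_pmf.prob ?M {f. \<forall>x\<in>h (fst i) ` snd i. \<not> f x} \<le> (1 / 8) ^ n" using vS by simp
  qed
  also have "\<dots> \<le> 4 ^ n * (1 / 8) ^ n" using cI by (intro mult_right_mono) auto
  also have "\<dots> = (1 / 2) ^ n" by (simp add: power_mult_distrib[symmetric])
  finally show ?thesis .
qed

lemma choose_two_ge:
  assumes "n \<le> 3 * m" "12 \<le> n"
  shows "real n ^ 2 / 36 \<le> real (m choose 2)"
proof -
  have m: "real n / 3 \<le> real m" "4 \<le> m" using assms by auto
  have "real (m choose 2) = real m * (real m - 1) / 2"
    using m(2) binomial_gbinomial[of m 2, where 'a = real] by (simp add: gbinomial_prod_rev numeral_2_eq_2)
  also have "\<dots> \<ge> real m * (real m / 2) / 2" using m(2) by (intro divide_right_mono mult_left_mono) auto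
  also have "real m * (real m / 2) / 2 = (real m)\<^sup>2 / 4" by (simp add: power2_eq_square)
  also have "(real m)\<^sup>2 / 4 \<ge> (real n / 3)\<^sup>2 / 4" using m(1) by (intro divide_right_mono power_mono) auto
  finally show ?thesis by (simp add: power_divide)
qed

text \<open>For one \<open>z\<close>, \<open>bipartite_concentration\<close> with
  \<open>d = n\<close> and the \<open>M\<close> sets at distance 2 has the exponent
  \<open>2 * (M / 1000000)\<^sup>2 / (n\<^sup>2 * M)\<close>, and \<open>M \<ge> n^4 / 1296\<close>
  makes it at least \<open>n\<^sup>2 / 648000000000000\<close>. There are at most
  \<open>2 ^ n\<close> choices of \<open>z\<close>. The parameters \<open>N\<close> and
  \<open>R\<close> allow upper and lower neighbours.\<close>

lemma prob_average_deviates: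
  fixes R :: "'a set \<Rightarrow> 'a set \<Rightarrow> bool"
  assumes G: "finite G" "card G = n" and n: "12 \<le> n" and p: "0 \<le> p" "p \<le> 1"
    and N: "\<And>i. N i \<subseteq> Pow G - nsets G i"
    and row: "\<And>i x. x \<in> nsets G i \<Longrightarrow> card {y \<in> N i. R x y} \<le> n"
    and col: "\<And>i y. y \<in> N i \<Longrightarrow> card {x \<in> nsets G i. R x y} \<le> n"
    and P: "\<And>i. P i \<Longrightarrow> n \<le> 3 * i \<and> 3 * i \<le> 2 * n"
  shows "measure_pmf.prob (Pi_pmf (Pow G) False (\<lambda>_. bernoulli_pmf p))
    {f. \<exists>z\<in>Pow G. P (card z) \<and> real ((card z choose 2) * ((n - card z) choose 2)) / 1000000 <
        \<bar>\<Sum>x | x \<in> {x \<in> nsets G (card z). card (x - z) = 2} \<and> f x.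
           \<Sum>y | y \<in> N (card z) \<and> R x y. of_bool (f y) - p\<bar>}
    \<le> 2 ^ n * (2 * exp (- (real n)\<^sup>2 / 648000000000000))" (is "measure_pmf.prob ?M ?B \<le> _")
proof -
  define M where "M = (\<lambda>i. real ((i choose 2) * ((n - i) choose 2)))"
  define I where "I = {z \<in> Pow G. P (card z)}"
  define E where "E = (\<lambda>z. {f. M (card z) / 1000000 < \<bar>\<Sum>x | x \<in> {x \<in> nsets G (card z). card (x - z) = 2} \<and> f x.
           \<Sum>y | y \<in> N (card z) \<and> R x y. of_bool (f y) - p\<bar>})"
  have "card I \<le> card (Pow G)" using G by (intro card_mono) (auto simp: I_def)
  hence cI: "real (card I) \<le> 2 ^ n" using G by (metis card_Pow of_nat_le_iff of_nat_numeral of_nat_power)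
  have "?B = (\<Union>z\<in>I. E z)" by (auto simp: I_def E_def M_def)
  also have "measure_pmf.prob ?M \<dots> \<le> card I * (2 * exp (- (real n)\<^sup>2 / 648000000000000))"
  proof (rule prob_UN_le)
    show "finite I" using G by (simp add: I_def)
    fix z assume "z \<in> I"
    hence z: "z \<subseteq> G" "P (card z)" by (auto simp: I_def)
    define i where "i = card z"
    have i: "n \<le> 3 * i" "n \<le> 3 * (n - i)" using P[OF z(2)] by (auto simp: i_def)
    have zi: "z \<in> nsets G i" using z G by (auto simp: nsets_def i_def finite_subset)
    have cF: "real (card {x \<in> nsets G i. card (x - z) = 2}) = M i"
      using card_nsets_at_distance[OF G(1) zi] G by (simp add: M_def)
    have "(real n ^ 2 / 36) * (real n ^ 2 / 36) \<le> real (i choose 2) * real ((n - i) choose 2)"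
      by (intro mult_mono choose_two_ge i n) auto
    hence M: "real n ^ 4 / 1296 \<le> M i" by (simp add: M_def power4_eq_xxxx power2_eq_square)
    have "measure_pmf.prob ?M (E z) \<le> 2 * exp (- 2 * (M i / 1000000)\<^sup>2 / (real n ^ 2 * card {x \<in> nsets G i. card (x - z) = 2}))"
      unfolding E_def i_def[symmetric]
    proof (rule bipartite_concentration)
      show "{x \<in> nsets G i. card (x - z) = 2} \<subseteq> Pow G" by (auto simp: nsets_def)
      show "N i \<subseteq> Pow G - {x \<in> nsets G i. card (x - z) = 2}" using N by auto
      show "card {y \<in> N i. R x y} \<le> n" if "x \<in> {x \<in> nsets G i. card (x - z) = 2}" for x
        using row that by auto
      show "card {x \<in> {x \<in> nsets G i. card (x - z) = 2}. R x y} \<le> n" if "y \<in> N i" for y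
        by (rule order_trans[OF card_mono col[OF that]]) (use G in \<open>auto simp: finite_imp_finite_nsets\<close>)
    qed (use G p in \<open>auto simp: M_def\<close>)
    also have "\<dots> \<le> 2 * exp (- (real n)\<^sup>2 / 648000000000000)"
    proof -
      have M0: "0 < M i" using M n by (intro less_le_trans[OF _ M]) simp
      have "(real n)\<^sup>2 / 648000000000000 = 2 * (real n ^ 4 / 1296) / (1000000000000 * (real n)\<^sup>2)"
        using n by (simp add: field_simps power4_eq_xxxx power2_eq_square)
      also have "\<dots> \<le> 2 * M i / (1000000000000 * (real n)\<^sup>2)"
        by (intro divide_right_mono mult_left_mono M) auto
      also have "\<dots> = 2 * (M i / 1000000)\<^sup>2 / (real n ^ 2 * M i)"
        using M0 n by (simp add: field_simps power2_eq_square)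
      finally show ?thesis unfolding cF by simp
    qed
    finally show "measure_pmf.prob ?M (E z) \<le> 2 * exp (- (real n)\<^sup>2 / 648000000000000)" .
  qed
  also have "\<dots> \<le> 2 ^ n * (2 * exp (- (real n)\<^sup>2 / 648000000000000))" using cI by (intro mult_right_mono) auto
  finally show ?thesis .
qed

section \<open>From independent bits to the width\<close>

text \<open>The inner sum of \<open>of_bool (f y) - p\<close> over all neighbours of
  \<open>x\<close> is the degree of \<open>x\<close> minus \<open>p\<close> times the number of its
  neighbours, so the sums controlled by concentration are those of the locale.\<close>

lemma typical_familyI:
  fixes f :: "'a set \<Rightarrow> bool"
  assumes G: "finite G" "card G = n" and n: "1000 \<le> n" and p: "1 - 1 / 100000 \<le> p" "p \<le> 1"
    and up: "\<And>v. v \<subseteq> G \<Longrightarrow> 100000 * card {l \<in> G - v. \<not> f (insert l v)} \<le> n"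
    and down: "\<And>v. v \<subseteq> G \<Longrightarrow> 100000 * card {l \<in> v. \<not> f (v - {l})} \<le> n"
    and up_avg: "\<And>i z. z \<in> nsets G i \<Longrightarrow> n \<le> 3 * i \<and> 3 * i + 3 \<le> 2 * n \<Longrightarrow>
        \<bar>\<Sum>x | x \<in> {x \<in> nsets G i. card (x - z) = 2} \<and> f x.
           \<Sum>y | y \<in> nsets G (Suc i) \<and> x \<subseteq> y. of_bool (f y) - p\<bar>
        \<le> real ((i choose 2) * ((n - i) choose 2)) / 1000000"
    and down_avg: "\<And>j z. z \<in> nsets G j \<Longrightarrow> 3 * j \<le> 2 * n \<and> n + 3 \<le> 3 * j \<Longrightarrow>
        \<bar>\<Sum>x | x \<in> {x \<in> nsets G j. card (x - z) = 2} \<and> f x.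
           \<Sum>y | y \<in> (if j = 0 then {} else nsets G (j - 1)) \<and> y \<subseteq> x. of_bool (f y) - p\<bar>
        \<le> real ((j choose 2) * ((n - j) choose 2)) / 1000000"
  shows "typical_family G n {A \<in> Pow G. f A} p"
proof
  let ?X = "{A \<in> Pow G. f A}"
  have inner: "(\<Sum>y\<in>Y. of_bool (f y) - p) = real (card {y \<in> Y. f y}) - p * real (card Y)" if "finite Y" for Y
    using that by (simp add: sum_subtractf of_bool_def sum.If_cases Int_def)
  show "finite G" "card G = n" "1000 \<le> n" "?X \<subseteq> Pow G" "1 - 1 / 100000 \<le> p" "p \<le> 1"
    using G n p by auto
  show "100000 * card {l \<in> G - v. insert l v \<notin> ?X} \<le> n" if "v \<subseteq> G" for v
  proof -
    have "{l \<in> G - v. insert l v \<notin> ?X} = {l \<in> G - v. \<not> f (insert l v)}" using that by auto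
    thus ?thesis using up[OF that] by simp
  qed
  show "100000 * card {l \<in> v. v - {l} \<notin> ?X} \<le> n" if "v \<subseteq> G" for v
  proof -
    have "{l \<in> v. v - {l} \<notin> ?X} = {l \<in> v. \<not> f (v - {l})}" using that by auto
    thus ?thesis using down[OF that] by simp
  qed
  show "\<bar>\<Sum>x | x \<in> ?X \<inter> nsets G i \<and> card (x - z) = 2. real (up_degree G ?X x) - p * real (n - i)\<bar>
        \<le> real ((i choose 2) * ((n - i) choose 2)) / 1000000"
    if i: "n \<le> 3 * i" "3 * i + 3 \<le> 2 * n" and z: "z \<in> nsets G i" for i z
  proof -
    have "\<bar>\<Sum>x | x \<in> {x \<in> nsets G i. card (x - z) = 2} \<and> f x.
           \<Sum>y | y \<in> nsets G (Suc i) \<and> x \<subseteq> y. of_bool (f y) - p\<bar> \<le> real ((i choose 2) * ((n - i) choose 2)) / 1000000"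
      using i by (intro up_avg z) auto
    also have "(\<Sum>x | x \<in> {x \<in> nsets G i. card (x - z) = 2} \<and> f x.
           \<Sum>y | y \<in> nsets G (Suc i) \<and> x \<subseteq> y. of_bool (f y) - p) =
        (\<Sum>x | x \<in> ?X \<inter> nsets G i \<and> card (x - z) = 2. real (up_degree G ?X x) - p * real (n - i))"
    proof (rule sum.cong)
      show "{x. x \<in> {x \<in> nsets G i. card (x - z) = 2} \<and> f x} = {x. x \<in> ?X \<inter> nsets G i \<and> card (x - z) = 2}"
        by (auto simp: nsets_def)
      fix x assume "x \<in> {x. x \<in> ?X \<inter> nsets G i \<and> card (x - z) = 2}"
      hence x: "x \<in> nsets G i" "x \<subseteq> G" "finite x" "card x = i" by (auto simp: nsets_def)
      let ?Y = "{y. y \<in> nsets G (Suc i) \<and> x \<subseteq> y}"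
      have "card ?Y = card {l \<in> G - x. insert l x \<in> nsets G (Suc i)}"
        using card_covers[OF G(1) x(1) order_refl] by simp
      also have "{l \<in> G - x. insert l x \<in> nsets G (Suc i)} = G - x" using x by (auto simp: nsets_def)
      finally have cY: "card ?Y = n - i" using x G by (simp add: card_Diff_subset)
      have "{y \<in> ?Y. f y} = {y \<in> ?X \<inter> nsets G (Suc i). x \<subseteq> y}" by (auto simp: nsets_def)
      hence "card {y \<in> ?Y. f y} = card {l \<in> G - x. insert l x \<in> ?X \<inter> nsets G (Suc i)}"
        using card_covers[OF G(1) x(1), of "?X \<inter> nsets G (Suc i)"] by simp
      also have "\<dots> = up_degree G ?X x"
        unfolding up_degree_def using x by (intro arg_cong[where f = card]) (auto simp: nsets_def)
      finally have cf: "card {y \<in> ?Y. f y} = up_degree G ?X x" .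
      have "finite ?Y" using finite_imp_finite_nsets[OF G(1)] by simp
      from inner[OF this] show "(\<Sum>y\<in>?Y. of_bool (f y) - p) = real (up_degree G ?X x) - p * real (n - i)"
        unfolding cf cY .
    qed
    finally show ?thesis .
  qed
  show "\<bar>\<Sum>y | y \<in> ?X \<inter> nsets G j \<and> card (y - z) = 2. real (down_degree ?X y) - p * real j\<bar>
        \<le> real ((j choose 2) * ((n - j) choose 2)) / 1000000"
    if j: "3 * j \<le> 2 * n" "n + 3 \<le> 3 * j" and z: "z \<in> nsets G j" for j z
  proof -
    obtain i where i: "j = Suc i" using j by (cases j) auto
    have "\<bar>\<Sum>x | x \<in> {x \<in> nsets G j. card (x - z) = 2} \<and> f x.
           \<Sum>y | y \<in> nsets G i \<and> y \<subseteq> x. of_bool (f y) - p\<bar> \<le> real ((j choose 2) * ((n - j) choose 2)) / 1000000"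
      using down_avg[OF z] j i by simp
    also have "(\<Sum>x | x \<in> {x \<in> nsets G j. card (x - z) = 2} \<and> f x.
           \<Sum>y | y \<in> nsets G i \<and> y \<subseteq> x. of_bool (f y) - p) =
        (\<Sum>y | y \<in> ?X \<inter> nsets G j \<and> card (y - z) = 2. real (down_degree ?X y) - p * real j)"
    proof (rule sum.cong)
      show "{x. x \<in> {x \<in> nsets G j. card (x - z) = 2} \<and> f x} = {x. x \<in> ?X \<inter> nsets G j \<and> card (x - z) = 2}"
        by (auto simp: nsets_def)
      fix x assume "x \<in> {x. x \<in> ?X \<inter> nsets G j \<and> card (x - z) = 2}"
      hence x: "x \<in> nsets G (Suc i)" "x \<subseteq> G" "finite x" "card x = Suc i" by (auto simp: nsets_def i)
      let ?Y = "{y. y \<in> nsets G i \<and> y \<subseteq> x}"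
      have "card ?Y = card {l \<in> x. x - {l} \<in> nsets G i}"
        using card_covered[OF G(1) x(1) order_refl] by simp
      also have "{l \<in> x. x - {l} \<in> nsets G i} = x" using x by (auto simp: nsets_def)
      finally have cY: "card ?Y = j" using x i by simp
      have "{y \<in> ?Y. f y} = {y \<in> ?X \<inter> nsets G i. y \<subseteq> x}" by (auto simp: nsets_def)
      hence "card {y \<in> ?Y. f y} = card {l \<in> x. x - {l} \<in> ?X \<inter> nsets G i}"
        using card_covered[OF G(1) x(1), of "?X \<inter> nsets G i"] by simp
      also have "\<dots> = down_degree ?X x"
        unfolding down_degree_def using x by (intro arg_cong[where f = card]) (auto simp: nsets_def)
      finally have cf: "card {y \<in> ?Y. f y} = down_degree ?X x" .
      have "finite ?Y" using finite_imp_finite_nsets[OF G(1)] by simp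
      from inner[OF this] show "(\<Sum>y\<in>?Y. of_bool (f y) - p) = real (down_degree ?X x) - p * real j"
        unfolding cf cY .
    qed
    finally show ?thesis .
  qed
qed

text \<open>The exponent \<open>K\<close> is kept symbolic because the simplifier would otherwise evaluate the power.\<close>

lemma prob_width_ge:
  assumes n: "1000 \<le> n" and K: "K = 100000" and p: "p \<le> 1" "1 - p \<le> (1 / 8) ^ K"
  shows "1 - (2 * (1 / 2) ^ n + 4 * 2 ^ n * exp (- (real n)\<^sup>2 / 648000000000000)) \<le>
    measure_pmf.prob (random_family n p)
      {X. width X = max (card (X \<inter> nsets {1..n} (n div 2))) (card (X \<inter> nsets {1..n} ((n + 1) div 2)))}"
    (is "1 - ?e \<le> measure_pmf.prob _ ?S")
proof -
  define G where "G = {1..n}"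
  have G: "finite G" "card G = n" by (auto simp: G_def)
  \<comment> \<open>The exponent 6 is enough because \<open>8 ^ 6\<close> exceeds 100000.\<close>
  have "(1 / 8 :: real) ^ K \<le> (1 / 8) ^ 6" using K by (intro power_decreasing) auto
  also have "\<dots> \<le> 1 / 100000" by (simp add: power_divide)
  finally have p_ge: "1 - 1 / 100000 \<le> p" using p by linarith
  hence p0: "0 \<le> p" by simp
  let ?M = "Pi_pmf (Pow G) False (\<lambda>_. bernoulli_pmf p)"
  define B1 where "B1 = {f. \<exists>v\<in>Pow G. n < K * card {l \<in> G - v. \<not> f (insert l v)}}"
  define B2 where "B2 = {f. \<exists>v\<in>Pow G. n < K * card {l \<in> v. \<not> f (v - {l})}}"
  define B3 where "B3 = {f. \<exists>z\<in>Pow G. (n \<le> 3 * card z \<and> 3 * card z + 3 \<le> 2 * n) \<and>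
        real ((card z choose 2) * ((n - card z) choose 2)) / 1000000 <
        \<bar>\<Sum>x | x \<in> {x \<in> nsets G (card z). card (x - z) = 2} \<and> f x.
           \<Sum>y | y \<in> nsets G (Suc (card z)) \<and> x \<subseteq> y. of_bool (f y) - p\<bar>}"
  \<comment> \<open>At level 0 the truncated \<open>card z - 1\<close> would give level 0 again, and
    \<open>prob_average_deviates\<close> requires \<open>N i\<close> to be disjoint from level
    \<open>i\<close>.\<close>
  define B4 where "B4 = {f. \<exists>z\<in>Pow G. (3 * card z \<le> 2 * n \<and> n + 3 \<le> 3 * card z) \<and>
        real ((card z choose 2) * ((n - card z) choose 2)) / 1000000 <
        \<bar>\<Sum>x | x \<in> {x \<in> nsets G (card z). card (x - z) = 2} \<and> f x.
           \<Sum>y | y \<in> (if card z = 0 then {} else nsets G (card z - 1)) \<and> y \<subseteq> x. of_bool (f y) - p\<bar>}"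
  have up_card: "card {y \<in> nsets G (Suc i). x \<subseteq> y} \<le> n" if "x \<in> nsets G i" for x i
    unfolding card_covers[OF G(1) that order_refl] G(2)[symmetric] using G(1) by (intro card_mono) auto
  have down_card: "card {x \<in> nsets G i. x \<subseteq> y} \<le> n" if "y \<in> nsets G (Suc i)" for y i
    unfolding card_covered[OF G(1) that order_refl] G(2)[symmetric] using G(1) that
    by (intro card_mono) (auto simp: nsets_def)
  have b1: "measure_pmf.prob ?M B1 \<le> (1 / 2) ^ n"
    unfolding B1_def by (rule prob_many_missing[OF G p]) (auto simp: inj_on_def)
  have b2: "measure_pmf.prob ?M B2 \<le> (1 / 2) ^ n"
    unfolding B2_def by (rule prob_many_missing[OF G p]) (auto simp: inj_on_def)
  have b3: "measure_pmf.prob ?M B3 \<le> 2 ^ n * (2 * exp (- (real n)\<^sup>2 / 648000000000000))"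
    unfolding B3_def
    by (rule prob_average_deviates[OF G _ p0 p(1), where N = "\<lambda>i. nsets G (Suc i)" and R = "(\<subseteq>)" and P = "\<lambda>i. n \<le> 3 * i \<and> 3 * i + 3 \<le> 2 * n"])
       (use n up_card down_card in \<open>auto simp: nsets_def\<close>)
  have b4: "measure_pmf.prob ?M B4 \<le> 2 ^ n * (2 * exp (- (real n)\<^sup>2 / 648000000000000))"
    unfolding B4_def
  proof (rule prob_average_deviates[OF G _ p0 p(1), where N = "\<lambda>i. if i = 0 then {} else nsets G (i - 1)"
       and R = "\<lambda>x y. y \<subseteq> x" and P = "\<lambda>j. 3 * j \<le> 2 * n \<and> n + 3 \<le> 3 * j"])
    show "12 \<le> n" using n by simp
    show "(if i = 0 then {} else nsets G (i - 1)) \<subseteq> Pow G - nsets G i" for i by (auto simp: nsets_def)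
    show "card {y \<in> if i = 0 then {} else nsets G (i - 1). y \<subseteq> x} \<le> n" if "x \<in> nsets G i" for i x
      using down_card that by (cases i) auto
    show "card {x \<in> nsets G i. y \<subseteq> x} \<le> n" if "y \<in> (if i = 0 then {} else nsets G (i - 1))" for i y
      using up_card that by (cases i) auto
  qed auto
  have sub: "- (B1 \<union> B2 \<union> B3 \<union> B4) \<subseteq> (\<lambda>f. {A \<in> Pow G. f A}) -` ?S"
  proof
    fix f assume f: "f \<in> - (B1 \<union> B2 \<union> B3 \<union> B4)"
    have "typical_family G n {A \<in> Pow G. f A} p"
    proof (rule typical_familyI[OF G n p_ge p(1)])
      show "100000 * card {l \<in> G - v. \<not> f (insert l v)} \<le> n" if "v \<subseteq> G" for v
        using f that unfolding B1_def K by (simp add: not_less)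
      show "100000 * card {l \<in> v. \<not> f (v - {l})} \<le> n" if "v \<subseteq> G" for v
        using f that unfolding B2_def K by (simp add: not_less)
    next
      fix i z assume z: "z \<in> nsets G i" and i: "n \<le> 3 * i \<and> 3 * i + 3 \<le> 2 * n"
      have "f \<notin> B3" "z \<in> Pow G" "i = card z" using f z by (auto simp: nsets_def)
      thus "\<bar>\<Sum>x | x \<in> {x \<in> nsets G i. card (x - z) = 2} \<and> f x.
           \<Sum>y | y \<in> nsets G (Suc i) \<and> x \<subseteq> y. of_bool (f y) - p\<bar>
        \<le> real ((i choose 2) * ((n - i) choose 2)) / 1000000"
        using i unfolding B3_def mem_Collect_eq not_less[symmetric] by blast
    next
      fix j z assume z: "z \<in> nsets G j" and j: "3 * j \<le> 2 * n \<and> n + 3 \<le> 3 * j"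
      have "f \<notin> B4" "z \<in> Pow G" "j = card z" using f z by (auto simp: nsets_def)
      thus "\<bar>\<Sum>x | x \<in> {x \<in> nsets G j. card (x - z) = 2} \<and> f x.
           \<Sum>y | y \<in> (if j = 0 then {} else nsets G (j - 1)) \<and> y \<subseteq> x. of_bool (f y) - p\<bar>
        \<le> real ((j choose 2) * ((n - j) choose 2)) / 1000000"
        using j unfolding B4_def mem_Collect_eq not_less[symmetric] by blast
    qed
    from typical_family.width_eq[OF this] show "f \<in> (\<lambda>f. {A \<in> Pow G. f A}) -` ?S"
      unfolding G_def by simp
  qed
  have "measure_pmf.prob ?M (B1 \<union> B2 \<union> B3 \<union> B4) \<le>
    measure_pmf.prob ?M B1 + measure_pmf.prob ?M B2 + measure_pmf.prob ?M B3 + measure_pmf.prob ?M B4"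
    by (intro order_trans[OF measure_Un_le] add_mono order_refl) auto
  also have "\<dots> \<le> ?e" using b1 b2 b3 b4 by simp
  finally have "1 - ?e \<le> 1 - measure_pmf.prob ?M (B1 \<union> B2 \<union> B3 \<union> B4)" by simp
  also have "\<dots> = measure_pmf.prob ?M (- (B1 \<union> B2 \<union> B3 \<union> B4))"
    using measure_pmf.prob_compl[of "B1 \<union> B2 \<union> B3 \<union> B4" ?M] by (simp add: Compl_eq_Diff_UNIV)
  also have "\<dots> \<le> measure_pmf.prob ?M ((\<lambda>f. {A \<in> Pow G. f A}) -` ?S)"
    using sub by (intro measure_pmf.finite_measure_mono) auto
  also have "\<dots> = measure_pmf.prob (random_family n p) ?S"
    by (simp add: random_family_def G_def)
  finally show ?thesis .
qed

theorem theorem5p1: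
  "\<exists>\<epsilon>::real. \<epsilon> > 0 \<and>
     (\<forall>p :: nat \<Rightarrow> real. (\<forall>n. 0 \<le> p n \<and> p n \<le> 1 \<and> p n > 1 - \<epsilon>) \<longrightarrow>
        (\<lambda>n. measure_pmf.prob (random_family n (p n))
               {\<X>. width \<X> = max (card (\<X> \<inter> nsets {1..n} (nat \<lfloor>real n / 2\<rfloor>)))
                                (card (\<X> \<inter> nsets {1..n} (nat \<lceil>real n / 2\<rceil>)))})
          \<longlonglongrightarrow> 1)"
proof -
  obtain K :: nat where K: "K = 100000" by blast
  show ?thesis
  proof (intro exI[of _ "(1 / 8) ^ K"] conjI allI impI)
  show "(0::real) < (1 / 8) ^ K" by (rule zero_less_power) simp
  \<comment> \<open>The bound in \<open>prob_width_ge\<close> is the same for all admissible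
    probabilities, so \<open>p\<close> may vary with \<open>n\<close>.\<close>
  fix p :: "nat \<Rightarrow> real"
  assume p: "\<forall>n. 0 \<le> p n \<and> p n \<le> 1 \<and> p n > 1 - (1 / 8) ^ K"
  have fl: "nat \<lfloor>real n / 2\<rfloor> = n div 2" for n by linarith
  have ce: "nat \<lceil>real n / 2\<rceil> = (n + 1) div 2" for n by linarith
  let ?P = "\<lambda>n. measure_pmf.prob (random_family n (p n))
    {\<X>. width \<X> = max (card (\<X> \<inter> nsets {1..n} (n div 2))) (card (\<X> \<inter> nsets {1..n} ((n + 1) div 2)))}"
  have "?P \<longlonglongrightarrow> 1"
  proof (rule tendsto_sandwich)
    \<comment> \<open>The factor \<open>2 ^ n\<close> from the union bound is beaten by an
      exponential whose exponent is quadratic in \<open>n\<close>.\<close>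
    show "(\<lambda>n. 1 - (2 * (1 / 2) ^ n + 4 * 2 ^ n * exp (- (real n)\<^sup>2 / 648000000000000))) \<longlonglongrightarrow> 1"
      by real_asymp
    show "eventually (\<lambda>n. 1 - (2 * (1 / 2) ^ n + 4 * 2 ^ n * exp (- (real n)\<^sup>2 / 648000000000000)) \<le> ?P n) sequentially"
      using eventually_ge_at_top[of 1000]
    proof eventually_elim
      case (elim n)
      show ?case
      proof (rule prob_width_ge[OF elim K])
        show "p n \<le> 1" using p by blast
        have "1 - (1 / 8) ^ K < p n" using p by blast
        thus "1 - p n \<le> (1 / 8) ^ K" by linarith
      qed
    qed
  qed auto
  thus "(\<lambda>n. measure_pmf.prob (random_family n (p n))
               {\<X>. width \<X> = max (card (\<X> \<inter> nsets {1..n} (nat \<lfloor>real n / 2\<rfloor>)))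
                                (card (\<X> \<inter> nsets {1..n} (nat \<lceil>real n / 2\<rceil>)))}) \<longlonglongrightarrow> 1"
    unfolding fl ce .
  qed
qed

end
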